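(* Let $\mathtt z>0$ satisfy $\mathtt z\le \mathfrak g^2/4$, and suppose that conditions (I), (ED0), (L0) and (C) below hold with constants $\mathfrak a,\nu_0,\mathfrak g>0$ and $\delta_n(\mathtt r_0(\mathtt z))\ge 0$. Then $$\mathbf P\big(\widetilde\theta\notin\Theta_n(\mathtt z)\big)\le 2e^{-\mathtt z}+8.4\,e^{-\mathfrak g^2/4}.$$
   Context: Setting. Fix integers $d,p\ge1$, $n\ge1$, a bandwidth $h>0$ and a point $x_0\in\mathbb R^d$. Let $X_1,\dots,X_n$ be i.i.d. random vectors in $\mathbb R^d$ with Lebesgue density $f$. Let $K:\mathbb R^d\to[0,\infty)$ be a bounded measurable kernel vanishing outside $[-1,1]^d$, and let $\psi_0,\dots,\psi_{p-1}:[-1,1]^d\to\mathbb R$ be bounded measurable functions with $\psi_0\equiv1$, linearly independent on $\{K>0\}$; write $\Psi(t)=(\psi_0(t),\dots,\psi_{p-1}(t))^\top$ (extended by $0$ outside $[-1,1]^d$). Put $T_i=(X_i-x_0)/h$ and define the local log-likelihood $$L(\theta)=\sum_{i=1}^n K(T_i)\Psi(T_i)^\top\theta-nh^d\int_{[-1,1]^d}K(t)\exp(\Psi(t)^\top\theta)\,dt,\qquad \theta\in\mathbb R^p.$$ Let $\widetilde\theta=\arg\max_\theta L(\theta)$ (the maximum likelihood estimator) and $\theta^*=\arg\max_\theta \mathbf E L(\theta)$ (both assumed to exist). Define $D_n^2(\theta)=-\nabla^2\mathbf E L(\theta)=nh^d\int K(t)\Psi(t)\Psi(t)^\top e^{\Psi(t)^\top\theta}dt$,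 $D_n^2=D_n^2(\theta^* )$ with $D_n$ its symmetric positive definite square root, score vector $\xi=D_n^{-1}\nabla L(\theta^* )$, and $V_n^2=\mathrm{Var}(\nabla L(\theta^* ))$ (assumed positive definite). Set $\zeta(p,\mathtt z)=\mathfrak a\nu_0(\sqrt p+\sqrt{2\mathtt z})$, $\mathtt r_0(\mathtt z)=4\mathfrak a\nu_0(\sqrt p+\sqrt{2\mathtt z})$ and $\Theta_n(\mathtt z)=\{\theta:\|D_n(\theta-\theta^* )\|\le\mathtt r_0(\mathtt z)\}$. $\|\cdot\|$ is the Euclidean norm on vectors and operator norm on matrices; $\succeq$ is the Loewner order. Conditions. (I): $\mathfrak a^2D_n^2\succeq V_n^2$. (ED0): with $\boldsymbol\zeta=V_n^{-1}\nabla L(\theta^* )-\mathbf E V_n^{-1}\nabla L(\theta^* )$, for all nonzero $\gamma\in\mathbb R^p$ and all $|\lambda|\le\mathfrak g$, $\log\mathbf E\exp(\lambda\gamma^\top\boldsymbol\zeta/\|\gamma\|)\le\nu_0^2\lambda^2/2$. (L0): for all $\theta\in\Theta_n(\mathtt z)$, $\|I_p-D_n^{-1}D_n^2(\theta)D_n^{-1}\|\le\delta_n(\mathtt r_0(\mathtt z))$. (C): $\mathtt r_0(\mathtt z)\,(1-\delta_n(\mathtt r_0(\mathtt z)))\ge2\zeta(p,\mathtt z)$. *)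

theory Defs
  imports "HOL-Probability.Probability"
begin

definition cube :: "(real^'d) set" where
  "cube = {t. \<forall>i. \<bar>t $ i\<bar> \<le> 1}"

definition loewner_le :: "real^'n^'n \<Rightarrow> real^'n^'n \<Rightarrow> bool" where
  "loewner_le A B \<longleftrightarrow> (\<forall>x. x \<bullet> (A *v x) \<le> x \<bullet> (B *v x))"

definition pos_def_mat :: "real^'n^'n \<Rightarrow> bool" where
  "pos_def_mat A \<longleftrightarrow> transpose A = A \<and> (\<forall>x. x \<noteq> 0 \<longrightarrow> 0 < x \<bullet> (A *v x))"

definition msqrt :: "real^'n^'n \<Rightarrow> real^'n^'n" where
  "msqrt A = (THE B. pos_def_mat B \<and> B ** B = A)"

definition loglik ::
  "(real^'d \<Rightarrow> real) \<Rightarrow> (real^'d \<Rightarrow> real^'p) \<Rightarrow> real \<Rightarrow> real^'d \<Rightarrow>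
   (nat \<Rightarrow> 'a \<Rightarrow> real^'d) \<Rightarrow> nat \<Rightarrow> 'a \<Rightarrow> real^'p \<Rightarrow> real" where
  "loglik K Psi h x0 X n \<omega> \<theta> =
     (\<Sum>i<n. K ((1/h) *\<^sub>R (X i \<omega> - x0)) * (Psi ((1/h) *\<^sub>R (X i \<omega> - x0)) \<bullet> \<theta>))
     - real n * h ^ CARD('d) * (LINT t:cube|lborel. K t * exp (Psi t \<bullet> \<theta>))"

definition loglik_grad ::
  "(real^'d \<Rightarrow> real) \<Rightarrow> (real^'d \<Rightarrow> real^'p) \<Rightarrow> real \<Rightarrow> real^'d \<Rightarrow>
   (nat \<Rightarrow> 'a \<Rightarrow> real^'d) \<Rightarrow> nat \<Rightarrow> 'a \<Rightarrow> real^'p \<Rightarrow> real^'p" where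
  "loglik_grad K Psi h x0 X n \<omega> \<theta> =
     (\<Sum>i<n. K ((1/h) *\<^sub>R (X i \<omega> - x0)) *\<^sub>R Psi ((1/h) *\<^sub>R (X i \<omega> - x0)))
     - (real n * h ^ CARD('d)) *\<^sub>R
         (\<chi> j. LINT t:cube|lborel. K t * Psi t $ j * exp (Psi t \<bullet> \<theta>))"

definition Dsq ::
  "(real^'d \<Rightarrow> real) \<Rightarrow> (real^'d \<Rightarrow> real^'p) \<Rightarrow> real \<Rightarrow> nat \<Rightarrow> real^'p \<Rightarrow> real^'p^'p" where
  "Dsq K Psi h n \<theta> =
     (\<chi> j k. real n * h ^ CARD('d) *
        (LINT t:cube|lborel. K t * Psi t $ j * Psi t $ k * exp (Psi t \<bullet> \<theta>)))"

definition cov_mat :: "'a measure \<Rightarrow> ('a \<Rightarrow> real^'p) \<Rightarrow> real^'p^'p" where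
  "cov_mat M Y = (\<chi> j k. integral\<^sup>L M (\<lambda>\<omega>. (Y \<omega> $ j - integral\<^sup>L M (\<lambda>\<omega>'. Y \<omega>' $ j)) *
                                           (Y \<omega> $ k - integral\<^sup>L M (\<lambda>\<omega>'. Y \<omega>' $ k))))"

end

theory Submission
  imports Defs
begin

text \<open>
  Let \<open>v = \<theta>tilde - \<theta>star\<close>. If the estimator lies outside the ball, then by concavity the gradient of
  the likelihood at the boundary point of the segment from \<open>\<theta>star\<close> to \<open>\<theta>tilde\<close> has a nonnegative
  component along \<open>v\<close>. Integrating the curvature bound (L0) from \<open>\<theta>star\<close> to that point gives
  \<open>\<nabla>L(\<theta>star) \<bullet> v \<ge> (1 - \<delta>) r0 |D v|\<close>, and (I) and (C) turn this into
  \<open>|V\<^sup>-\<^sup>1 \<nabla>L(\<theta>star)| \<ge> 2 \<nu>0 (\<surd>p + \<surd>(2z))\<close>. Comparing gradients instead of likelihood values is what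
  yields the factor 2.

  The vector \<open>V\<^sup>-\<^sup>1 \<nabla>L(\<theta>star)\<close> is centred because \<open>\<theta>star\<close> maximises the expected likelihood. Its norm is
  controlled by averaging the exponential moment bound (ED0) over a Gaussian direction of variance
  \<open>z / (\<surd>p + \<surd>(2z))\<^sup>2\<close>, truncated to the ball in which (ED0) is available. Thanks to the factor 2 this
  variance is small enough for the truncation to cost only a factor 2, whatever the relation between
  \<open>g\<close> and \<open>p\<close>, so the probability is at most \<open>2 exp (- z)\<close>.
\<close>

section \<open>Square roots of positive definite matrices\<close>

text \<open>A maximiser \<open>x\<close> of the Rayleigh quotient on the unit sphere of
  \<open>S\<close> is an eigenvector: the first-order condition makes \<open>f x\<close> orthogonal
  to every \<open>y\<close> in \<open>S\<close> with \<open>y \<bullet> x = 0\<close>, and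
  invariance of \<open>S\<close> puts \<open>f x - (x \<bullet> f x) *\<^sub>R x\<close> among these
  \<open>y\<close>.\<close>

lemma self_adjoint_eigenvector:
  fixes f :: "'a::euclidean_space \<Rightarrow> 'a"
  assumes f: "linear f" and sym: "\<And>x y. f x \<bullet> y = x \<bullet> f y"
    and S: "subspace S" "f ` S \<subseteq> S" "S \<noteq> {0}"
  obtains x where "x \<in> S" "norm x = 1" "f x = (x \<bullet> f x) *\<^sub>R x"
proof -
  let ?U = "sphere 0 1 \<inter> S"
  obtain s where s: "s \<in> S" "s \<noteq> 0" using S subspace_0 by blast
  have "(1 / norm s) *\<^sub>R s \<in> ?U" using s S by (simp add: subspace_scale)
  hence ne: "?U \<noteq> {}" by blast
  have cpt: "compact ?U" using S(1) by (simp add: closed_subspace compact_Int_closed)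
  have cont: "continuous_on ?U (\<lambda>x. x \<bullet> f x)"
    by (intro continuous_intros linear_continuous_on) (use f in \<open>simp add: linear_conv_bounded_linear\<close>)
  obtain x where x: "x \<in> ?U" and mx: "\<And>y. y \<in> ?U \<Longrightarrow> y \<bullet> f y \<le> x \<bullet> f x"
    using continuous_attains_sup[OF cpt ne cont] by blast
  let ?m = "x \<bullet> f x"
  have xx: "x \<bullet> x = 1" using x by (simp add: dot_square_norm)
  have bound: "y \<bullet> f y \<le> ?m * (y \<bullet> y)" if "y \<in> S" for y
  proof (cases "y = 0")
    case True then show ?thesis using f by (simp add: linear_0)
  next
    case False
    let ?y = "(1 / norm y) *\<^sub>R y"
    have "?y \<in> ?U" using that S False by (simp add: subspace_scale)
    from mx[OF this] have "(y \<bullet> f y) / (norm y)\<^sup>2 \<le> ?m"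
      using f by (simp add: linear_scale power2_eq_square)
    thus ?thesis using False by (simp add: divide_le_eq dot_square_norm)
  qed
  have orth: "y \<bullet> f x = 0" if y: "y \<in> S" "y \<bullet> x = 0" for y
  proof -
    let ?c = "?m * (y \<bullet> y) - y \<bullet> f y"
    have c0: "?c \<ge> 0" using bound y by simp
    \<comment> \<open>This is \<open>bound\<close> at the perturbed point
      \<open>x + t *\<^sub>R y\<close>: a linear term in \<open>t\<close> dominated by a quadratic
      one for all \<open>t\<close> must vanish.\<close>
    have ineq: "2 * t * (y \<bullet> f x) \<le> t\<^sup>2 * ?c" for t
    proof -
      have "x + t *\<^sub>R y \<in> S" using x y S by (simp add: subspace_add subspace_scale)
      from bound[OF this] show ?thesis
        using f y xx sym[of x y] sym[of y x]
        by (simp add: linear_add linear_scale inner_simps inner_commute power2_eq_square algebra_simps)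
    qed
    define q where "q = y \<bullet> f x"
    \<comment> \<open>The choice \<open>t = q / (?c + 1)\<close> almost optimises the inequality;
      the \<open>+ 1\<close> keeps the denominator positive when \<open>?c = 0\<close>.\<close>
    have "2 * (q / (?c + 1)) * q \<le> (q / (?c + 1))\<^sup>2 * ?c" using ineq q_def by blast
    also have "\<dots> \<le> (q / (?c + 1))\<^sup>2 * (?c + 1)" by (intro mult_left_mono) auto
    also have "\<dots> = q\<^sup>2 / (?c + 1)" using c0 by (simp add: power2_eq_square)
    finally have "2 * q\<^sup>2 / (?c + 1) \<le> q\<^sup>2 / (?c + 1)" by (simp add: power2_eq_square)
    hence "q\<^sup>2 \<le> 0" using c0 by (simp add: divide_le_cancel split: if_splits)
    thus ?thesis by (simp add: q_def)
  qed
  let ?y = "f x - ?m *\<^sub>R x"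
  have yS: "?y \<in> S" using x S by (auto intro!: subspace_diff subspace_scale)
  have yx: "?y \<bullet> x = 0" using xx by (simp add: inner_simps inner_commute)
  have "?y \<bullet> ?y = ?y \<bullet> f x - ?m * (?y \<bullet> x)" by (simp add: inner_simps)
  hence "?y \<bullet> ?y = 0" using orth[OF yS yx] yx by simp
  hence "f x = ?m *\<^sub>R x" by simp
  moreover have "x \<in> S" "norm x = 1" using x by auto
  ultimately show thesis using that by blast
qed

text \<open>Induction on the dimension: split off one unit eigenvector \<open>x\<close>; by symmetry
  of \<open>f\<close> its orthogonal complement \<open>T\<close> in \<open>S\<close> is again
  invariant and has smaller dimension.\<close>

lemma self_adjoint_eigenbasis:
  fixes f :: "'a::euclidean_space \<Rightarrow> 'a"
  assumes f: "linear f" and sym: "\<And>x y. f x \<bullet> y = x \<bullet> f y"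
    and "subspace S" "f ` S \<subseteq> S"
  shows "\<exists>B. finite B \<and> pairwise orthogonal B \<and> span B = S
    \<and> (\<forall>b\<in>B. norm b = 1 \<and> f b = (b \<bullet> f b) *\<^sub>R b)"
  using assms(3,4)
proof (induction "dim S" arbitrary: S rule: less_induct)
  case less
  show ?case
  proof (cases "S = {0}")
    case True
    then show ?thesis by (intro exI[of _ "{}"]) simp
  next
    case False
    then obtain x where x: "x \<in> S" "norm x = 1" "f x = (x \<bullet> f x) *\<^sub>R x"
      using self_adjoint_eigenvector[OF f sym less.prems] by blast
    have xx: "x \<bullet> x = 1" using x by (simp add: dot_square_norm)
    define T where "T = {y \<in> S. y \<bullet> x = 0}"
    have T: "subspace T" using less.prems(1)
      by (auto simp: T_def subspace_def inner_simps)
    have inv: "f ` T \<subseteq> T"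
    proof safe
      fix y assume y: "y \<in> T"
      have "f y \<bullet> x = (x \<bullet> f x) * (y \<bullet> x)" using sym[of y x] x(3) by (metis inner_scaleR_right)
      with y show "f y \<in> T" using less.prems(2) by (auto simp: T_def)
    qed
    have "x \<notin> T" using xx by (simp add: T_def)
    hence "T \<subset> S" using x(1) unfolding T_def by blast
    hence "dim T < dim S" using T less.prems(1)
      by (metis dim_psubset span_eq_iff)
    from less.hyps[OF this T inv] obtain B where B: "finite B" "pairwise orthogonal B" "span B = T"
      "\<forall>b\<in>B. norm b = 1 \<and> f b = (b \<bullet> f b) *\<^sub>R b" by blast
    have BT: "B \<subseteq> T" using B(3) span_superset by blast
    have "span (insert x B) = S"
    proof
      show "span (insert x B) \<subseteq> S"
        using BT x less.prems(1) by (intro span_minimal) (auto simp: T_def)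
      show "S \<subseteq> span (insert x B)"
      proof
        fix y assume y: "y \<in> S"
        have "y - (y \<bullet> x) *\<^sub>R x \<in> T"
          using y x xx less.prems(1) by (simp add: T_def subspace_diff subspace_scale inner_simps)
        thus "y \<in> span (insert x B)" using B(3) by (auto simp: span_insert)
      qed
    qed
    moreover have "pairwise orthogonal (insert x B)"
      using B(2) BT by (auto simp: pairwise_insert T_def orthogonal_def inner_commute)
    ultimately show ?thesis using B x by (intro exI[of _ "insert x B"]) auto
  qed
qed

section \<open>Symmetric real matrices and their eigenbases\<close>

lemma symmetric_matrix_inner:
  fixes A :: "real^'n^'n"
  assumes "transpose A = A"
  shows "(A *v x) \<bullet> y = x \<bullet> (A *v y)"
  by (metis assms dot_lmul_matrix inner_commute transpose_matrix_vector)

lemma symmetric_matrixI: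
  fixes A :: "real^'n^'n"
  assumes "\<And>x y. (A *v x) \<bullet> y = x \<bullet> (A *v y)"
  shows "transpose A = A"
  by (metis assms matrix_eq vector_eq_rdot dot_lmul_matrix transpose_matrix_vector)

lemma symmetric_matrix_eigenbasis:
  fixes A :: "real^'n^'n"
  assumes "transpose A = A"
  obtains B where "finite B" "pairwise orthogonal B" "span B = UNIV"
    "\<And>b. b \<in> B \<Longrightarrow> norm b = 1" "\<And>b. b \<in> B \<Longrightarrow> A *v b = (b \<bullet> (A *v b)) *\<^sub>R b"
  using self_adjoint_eigenbasis[of "(*v) A" UNIV] symmetric_matrix_inner[OF assms]
  by (metis (no_types) matrix_vector_mul_linear subset_UNIV subspace_UNIV)

lemma symmetric_matrix_eq_0:
  fixes A :: "real^'n^'n"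
  assumes sym: "transpose A = A"
    and ev: "\<And>x c. x \<noteq> 0 \<Longrightarrow> A *v x = c *\<^sub>R x \<Longrightarrow> c = 0"
  shows "A = 0"
proof -
  obtain B where B: "span B = UNIV" "\<And>b. b \<in> B \<Longrightarrow> norm b = 1"
    "\<And>b. b \<in> B \<Longrightarrow> A *v b = (b \<bullet> (A *v b)) *\<^sub>R b"
    using symmetric_matrix_eigenbasis[OF sym] by metis
  have "A *v b = 0" if "b \<in> B" for b
    using B(2,3)[OF that] ev[of b "b \<bullet> (A *v b)"] by (metis norm_zero scaleR_zero_left zero_neq_one)
  hence "A *v x = 0" for x
    using linear_eq_0_on_span[OF matrix_vector_mul_linear, of B A x] B(1) by auto
  thus ?thesis by (metis matrix_eq matrix_vector_mult_0)
qed

text \<open>The root keeps the orthonormal eigenbasis \<open>B\<close> of \<open>A\<close> and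
  replaces each eigenvalue \<open>l b > 0\<close> by \<open>sqrt (l b)\<close>.\<close>

lemma pos_def_sqrt_exists:
  fixes A :: "real^'n^'n"
  assumes A: "pos_def_mat A"
  shows "\<exists>R. pos_def_mat R \<and> R ** R = A"
proof -
  have sym: "transpose A = A" using A by (simp add: pos_def_mat_def)
  obtain B where B: "finite B" "pairwise orthogonal B" "span B = UNIV"
    "\<And>b. b \<in> B \<Longrightarrow> norm b = 1" "\<And>b. b \<in> B \<Longrightarrow> A *v b = (b \<bullet> (A *v b)) *\<^sub>R b"
    using symmetric_matrix_eigenbasis[OF sym] by metis
  define l where "l b = b \<bullet> (A *v b)" for b
  have l: "l b > 0" if "b \<in> B" for b
    using A B(4)[OF that] unfolding l_def pos_def_mat_def by (metis norm_zero zero_neq_one)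
  define f where "f x = (\<Sum>b\<in>B. (sqrt (l b) * (b \<bullet> x)) *\<^sub>R b)" for x
  have lin: "linear f"
    unfolding f_def by (intro linear_compose_sum ballI linearI)
      (auto simp: inner_simps algebra_simps)
  have dotb: "b \<bullet> c = (if b = c then 1 else 0)" if "b \<in> B" "c \<in> B" for b c
    using B(2) B(4) that by (auto simp: pairwise_def orthogonal_def dot_square_norm)
  have expand: "x = (\<Sum>b\<in>B. (b \<bullet> x) *\<^sub>R b)" for x
    using orthonormal_basis_expand[of B x] B by (simp add: inner_commute)
  have bf: "b \<bullet> f x = sqrt (l b) * (b \<bullet> x)" if "b \<in> B" for b x
    using that B(1) by (simp add: f_def inner_sum_right dotb if_distrib cong: if_cong)
  define R where "R = matrix f"
  have R: "R *v x = f x" for x using lin by (simp add: R_def matrix_works)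
  have "transpose R = R"
    by (rule symmetric_matrixI) (simp add: R f_def inner_sum_left inner_sum_right inner_commute mult_ac)
  moreover have "0 < x \<bullet> (R *v x)" if "x \<noteq> 0" for x
  proof -
    obtain c where c: "c \<in> B" "c \<bullet> x \<noteq> 0"
    proof (rule ccontr)
      assume "\<not> thesis"
      hence "(\<Sum>b\<in>B. (b \<bullet> x) *\<^sub>R b) = 0" using that by (intro sum.neutral) auto
      with expand[of x] \<open>x \<noteq> 0\<close> show False by simp
    qed
    have "0 < (\<Sum>b\<in>B. sqrt (l b) * (b \<bullet> x)\<^sup>2)"
      using B(1) c l by (intro sum_pos2[of B c]) (auto intro!: mult_nonneg_nonneg simp: less_imp_le)
    thus ?thesis by (simp add: R f_def inner_sum_right inner_commute power2_eq_square mult_ac)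
  qed
  moreover have "R ** R = A"
  proof -
    have "R *v (R *v x) = A *v x" for x
    proof -
      have "R *v (R *v x) = (\<Sum>b\<in>B. (sqrt (l b) * (sqrt (l b) * (b \<bullet> x))) *\<^sub>R b)"
        using bf by (simp add: R f_def[of "f x"])
      also have "\<dots> = (\<Sum>b\<in>B. (b \<bullet> x) *\<^sub>R (A *v b))"
      proof (rule sum.cong)
        fix b assume b: "b \<in> B"
        have "sqrt (l b) * sqrt (l b) = l b" using l[OF b] by simp
        thus "(sqrt (l b) * (sqrt (l b) * (b \<bullet> x))) *\<^sub>R b = (b \<bullet> x) *\<^sub>R (A *v b)"
          using B(5)[OF b] by (metis l_def mult.assoc mult.commute scaleR_scaleR)
      qed simp
      also have "\<dots> = A *v (\<Sum>b\<in>B. (b \<bullet> x) *\<^sub>R b)"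
        by (simp add: linear_sum[OF matrix_vector_mul_linear] matrix_vector_mult_scaleR)
      finally show ?thesis unfolding expand[of x, symmetric] .
    qed
    thus ?thesis by (simp add: matrix_eq flip: matrix_vector_mul_assoc)
  qed
  ultimately show ?thesis unfolding pos_def_mat_def by blast
qed

text \<open>An eigenvector \<open>x\<close> of \<open>R - S\<close> with eigenvalue \<open>c\<close>
  satisfies \<open>c * (x \<bullet> (R *v x) + x \<bullet> (S *v x)) = 0\<close>, because
  \<open>R *v x\<close> and \<open>S *v x\<close> have equal norm. The bracket is positive, so all
  eigenvalues of the symmetric matrix \<open>R - S\<close> are zero.\<close>

lemma pos_def_sqrt_unique:
  fixes R S :: "real^'n^'n"
  assumes R: "pos_def_mat R" and S: "pos_def_mat S" and eq: "R ** R = S ** S"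
  shows "R = S"
proof -
  have sym: "transpose R = R" "transpose S = S" using R S by (auto simp: pos_def_mat_def)
  have "R - S = 0"
  proof (rule symmetric_matrix_eq_0)
    show "transpose (R - S) = R - S"
      using sym by (simp add: transpose_def vec_eq_iff)
    fix x c assume x: "x \<noteq> 0" and c: "(R - S) *v x = c *\<^sub>R x"
    have Rx: "R *v x = S *v x + c *\<^sub>R x" using c by (simp add: matrix_vector_mult_diff_rdistrib algebra_simps)
    have "R *v (R *v x) = S *v (S *v x)" using eq by (simp add: matrix_vector_mul_assoc)
    hence "x \<bullet> (R *v (R *v x)) = x \<bullet> (S *v (S *v x))" by simp
    hence "(R *v x) \<bullet> (R *v x) = (S *v x) \<bullet> (S *v x)"
      by (simp add: symmetric_matrix_inner[OF sym(1)] symmetric_matrix_inner[OF sym(2)])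
    \<comment> \<open>Vectors of equal norm have orthogonal sum and difference; this replaces
      commutativity of \<open>R\<close> and \<open>S\<close>.\<close>
    hence "((R *v x) - (S *v x)) \<bullet> (R *v x + S *v x) = 0"
      by (simp add: inner_simps inner_commute)
    moreover have "(R *v x) - (S *v x) = c *\<^sub>R x" using Rx by simp
    ultimately have "c * (x \<bullet> (R *v x) + x \<bullet> (S *v x)) = 0"
      by (metis inner_add_right inner_scaleR_left)
    moreover have "x \<bullet> (R *v x) + x \<bullet> (S *v x) > 0"
      using R S x by (simp add: pos_def_mat_def add_pos_pos)
    ultimately show "c = 0" by (metis less_irrefl mult_eq_0_iff)
  qed
  thus ?thesis by simp
qed

lemma msqrt:
  assumes "pos_def_mat A"
  shows "pos_def_mat (msqrt A)" "msqrt A ** msqrt A = A"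
proof -
  have "\<exists>!R. pos_def_mat R \<and> R ** R = A"
    using pos_def_sqrt_exists[OF assms] pos_def_sqrt_unique by metis
  from theI'[OF this] show "pos_def_mat (msqrt A)" "msqrt A ** msqrt A = A"
    by (auto simp: msqrt_def)
qed

section \<open>Inverses of positive definite matrices\<close>

lemma pos_def_invertible:
  fixes A :: "real^'n^'n"
  assumes "pos_def_mat A"
  shows "invertible A"
  unfolding invertible_left_inverse matrix_left_invertible_ker
  using assms by (metis inner_zero_right less_irrefl pos_def_mat_def)

lemma matrix_inv_mult:
  fixes A :: "real^'n^'n"
  assumes "invertible A"
  shows "A *v (matrix_inv A *v x) = x" "matrix_inv A *v (A *v x) = x"
proof -
  have "A ** matrix_inv A = mat 1 \<and> matrix_inv A ** A = mat 1"
    using assms unfolding invertible_def matrix_inv_def by (rule someI_ex)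
  thus "A *v (matrix_inv A *v x) = x" "matrix_inv A *v (A *v x) = x"
    by (simp_all add: matrix_vector_mul_assoc)
qed

lemma symmetric_matrix_inv:
  fixes A :: "real^'n^'n"
  assumes "pos_def_mat A"
  shows "transpose (matrix_inv A) = matrix_inv A"
proof (rule symmetric_matrixI)
  fix x y
  have sym: "transpose A = A" using assms by (simp add: pos_def_mat_def)
  note inv = matrix_inv_mult[OF pos_def_invertible[OF assms]]
  show "(matrix_inv A *v x) \<bullet> y = x \<bullet> (matrix_inv A *v y)"
    using symmetric_matrix_inner[OF sym, of "matrix_inv A *v x" "matrix_inv A *v y"] by (simp add: inv)
qed

section \<open>Norms of sub-Gaussian vectors\<close>

text \<open>Exponential tilting: multiplying the standard normal density by
  \<open>exp (c * x)\<close> gives the normal density with mean \<open>c\<close>, up to the factor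
  \<open>exp (c\<^sup>2 / 2)\<close>. The second integral is therefore that factor times the second
  moment \<open>1 + c\<^sup>2\<close> of the shifted law.\<close>

lemma std_normal_mgf:
  fixes c :: real
  shows "has_bochner_integral (density lborel std_normal_density) (\<lambda>x. exp (c * x)) (exp (c\<^sup>2 / 2))"
    and "has_bochner_integral (density lborel std_normal_density) (\<lambda>x. x\<^sup>2 * exp (c * x))
           ((1 + c\<^sup>2) * exp (c\<^sup>2 / 2))"
proof -
  have tilt: "std_normal_density x * exp (c * x) = normal_density c 1 x * exp (c\<^sup>2 / 2)" for x
    by (simp add: std_normal_density_def normal_density_def power2_diff diff_divide_distrib
        add_divide_distrib flip: exp_add)
  have "has_bochner_integral lborel (\<lambda>x. normal_density c 1 x * exp (c\<^sup>2 / 2)) (1 * exp (c\<^sup>2 / 2))"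
    by (intro has_bochner_integral_mult_left) (simp_all add: has_bochner_integral_iff)
  thus "has_bochner_integral (density lborel std_normal_density) (\<lambda>x. exp (c * x)) (exp (c\<^sup>2 / 2))"
    by (intro has_bochner_integral_density) (simp_all add: tilt)
  \<comment> \<open>The second moment is assembled from the variance and the mean through
    \<open>x\<^sup>2 = (x - c)\<^sup>2 + 2 * c * x - c\<^sup>2\<close>.\<close>
  have "has_bochner_integral lborel (\<lambda>x. normal_density c 1 x * (x - c)^(2*1)
      + 2 * c * (normal_density c 1 x * x) - c\<^sup>2 * normal_density c 1 x)
      (1 + 2 * c * c - c\<^sup>2 * 1)"
    using normal_moment_even[of 1 c 1]
    by (intro has_bochner_integral_add has_bochner_integral_diff has_bochner_integral_mult_right
        normal_moment_nz_1) (simp_all add: has_bochner_integral_iff)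
  also have "(\<lambda>x. normal_density c 1 x * (x - c)^(2*1)
      + 2 * c * (normal_density c 1 x * x) - c\<^sup>2 * normal_density c 1 x) = (\<lambda>x. normal_density c 1 x * x\<^sup>2)"
    by (simp add: fun_eq_iff power2_diff algebra_simps power2_eq_square)
  finally have "has_bochner_integral lborel (\<lambda>x. normal_density c 1 x * x\<^sup>2 * exp (c\<^sup>2 / 2))
      ((1 + 2 * c * c - c\<^sup>2 * 1) * exp (c\<^sup>2 / 2))"
    by (intro has_bochner_integral_mult_left) simp_all
  also have "(\<lambda>x. normal_density c 1 x * x\<^sup>2 * exp (c\<^sup>2 / 2)) =
      (\<lambda>x. std_normal_density x * (x\<^sup>2 * exp (c * x)))"
    by (metis (no_types, opaque_lifting) tilt mult.assoc mult.commute)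
  finally show "has_bochner_integral (density lborel std_normal_density) (\<lambda>x. x\<^sup>2 * exp (c * x))
           ((1 + c\<^sup>2) * exp (c\<^sup>2 / 2))"
    by (intro has_bochner_integral_density) (simp_all add: power2_eq_square add.commute)
qed

text \<open>The integrand against Lebesgue measure is \<open>\<tau>\<close> times a centred normal
  density with standard deviation \<open>\<tau> = 1 / sqrt (1 - \<sigma>)\<close>.\<close>

lemma std_normal_exp_square:
  fixes \<sigma> :: real
  assumes "\<sigma> < 1"
  shows "(\<integral>\<^sup>+x. ennreal (exp (\<sigma> * x\<^sup>2 / 2)) \<partial>density lborel std_normal_density) = ennreal (1 / sqrt (1 - \<sigma>))"
proof -
  define \<tau> where "\<tau> = 1 / sqrt (1 - \<sigma>)"
  have \<tau>: "\<tau> > 0" "\<tau>\<^sup>2 = 1 / (1 - \<sigma>)" using assms by (auto simp: \<tau>_def power_divide)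
  have *: "std_normal_density x * exp (\<sigma> * x\<^sup>2 / 2) = \<tau> * normal_density 0 \<tau> x" for x
  proof -
    have "exp (- (x\<^sup>2 / 2)) * exp (\<sigma> * x\<^sup>2 / 2) = exp (- (x\<^sup>2 / (2 * \<tau>\<^sup>2)))"
      unfolding \<tau>(2) using assms by (simp add: field_simps flip: exp_add)
    moreover have "\<tau> / sqrt (2 * pi * \<tau>\<^sup>2) = 1 / sqrt (2 * pi)" using \<tau>(1) by (simp add: real_sqrt_mult)
    ultimately show ?thesis
      by (simp add: std_normal_density_def normal_density_def) (metis times_divide_eq_left times_divide_eq_right mult.left_neutral mult.commute)
  qed
  have "(\<integral>\<^sup>+x. ennreal (exp (\<sigma> * x\<^sup>2 / 2)) \<partial>density lborel std_normal_density)
      = (\<integral>\<^sup>+x. ennreal (\<tau> * normal_density 0 \<tau> x) \<partial>lborel)"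
    by (simp add: nn_integral_density * flip: ennreal_mult')
  also have "\<dots> = ennreal (\<integral>x. \<tau> * normal_density 0 \<tau> x \<partial>lborel)"
    using \<tau>(1) by (intro nn_integral_eq_integral) (auto simp: less_imp_le)
  also have "\<dots> = ennreal \<tau>" using \<tau>(1) by simp
  finally show ?thesis by (simp add: \<tau>_def)
qed

text \<open>A standard Gaussian vector is encoded by its independent coordinates: \<open>gauss\<close> is the law of
  the coordinates and \<open>gauss_vec\<close> assembles the vector.\<close>

definition gauss :: "('a::euclidean_space \<Rightarrow> real) measure" where
  "gauss = (\<Pi>\<^sub>M b\<in>(Basis :: 'a set). density lborel std_normal_density)"

definition gauss_vec :: "('a::euclidean_space \<Rightarrow> real) \<Rightarrow> 'a" where
  "gauss_vec x = (\<Sum>b\<in>Basis. x b *\<^sub>R b)"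

lemma gauss_vec_inner: "gauss_vec x \<bullet> y = (\<Sum>b\<in>Basis. x b * (y \<bullet> b))"
  unfolding gauss_vec_def inner_sum_left inner_scaleR_left by (simp add: inner_commute)

lemma norm_gauss_vec: "(norm (gauss_vec x))\<^sup>2 = (\<Sum>b\<in>Basis. (x b)\<^sup>2)" for x :: "'a::euclidean_space \<Rightarrow> real"
  unfolding power2_norm_eq_inner
proof (subst gauss_vec_inner, rule sum.cong)
  fix b :: 'a assume "b \<in> Basis"
  thus "x b * (gauss_vec x \<bullet> b) = (x b)\<^sup>2" by (simp add: gauss_vec_def power2_eq_square)
qed simp

lemma prob_space_std_normal: "prob_space (density lborel std_normal_density)"
  by (simp add: prob_space_normal_density)

lemma prob_space_gauss: "prob_space gauss"
  unfolding gauss_def by (intro prob_space_PiM prob_space_std_normal)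

lemma gauss_vec_measurable [measurable]: "(gauss_vec :: ('a::euclidean_space \<Rightarrow> real) \<Rightarrow> 'a) \<in> borel_measurable gauss"
proof -
  have "(\<lambda>x. \<Sum>b\<in>Basis. x b *\<^sub>R b) \<in> borel_measurable (gauss :: ('a \<Rightarrow> real) measure)"
    unfolding gauss_def by measurable
  thus ?thesis by (simp add: gauss_vec_def[abs_def])
qed

text \<open>Both integrals factor over the independent coordinates. For the second, the squared norm
  is first split into its coordinates; each summand is a product in which a single factor carries
  the square.\<close>

lemma gauss_mgf:
  fixes y :: "'a::euclidean_space"
  shows "has_bochner_integral gauss (\<lambda>x. exp (gauss_vec x \<bullet> y)) (exp ((norm y)\<^sup>2 / 2))"
    and "has_bochner_integral gauss (\<lambda>x. (norm (gauss_vec x))\<^sup>2 * exp (gauss_vec x \<bullet> y))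
           ((DIM('a) + (norm y)\<^sup>2) * exp ((norm y)\<^sup>2 / 2))"
proof -
  interpret N: prob_space "density lborel std_normal_density" by (rule prob_space_std_normal)
  interpret product_sigma_finite "\<lambda>b::'a. density lborel std_normal_density" ..
  have ny: "(norm y)\<^sup>2 = (\<Sum>b\<in>Basis. (y \<bullet> b)\<^sup>2)"
    unfolding power2_norm_eq_inner by (subst euclidean_inner) (simp add: power2_eq_square)
  have e: "exp (gauss_vec x \<bullet> y) = (\<Prod>b\<in>Basis. exp ((y \<bullet> b) * x b))" for x
    by (simp add: gauss_vec_inner exp_sum mult.commute)
  have ey: "exp ((norm y)\<^sup>2 / 2) = (\<Prod>b\<in>Basis. exp ((y \<bullet> b)\<^sup>2 / 2))"
    by (simp add: ny sum_divide_distrib exp_sum)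
  have "integrable gauss (\<lambda>x. \<Prod>b\<in>Basis. exp ((y \<bullet> b) * x b))"
    unfolding gauss_def using std_normal_mgf(1)
    by (intro product_integrable_prod) (auto simp: has_bochner_integral_iff)
  moreover have "(\<integral>x. (\<Prod>b\<in>Basis. exp ((y \<bullet> b) * x b)) \<partial>gauss) = (\<Prod>b\<in>Basis. exp ((y \<bullet> b)\<^sup>2 / 2))"
    unfolding gauss_def using std_normal_mgf(1)
    by (subst product_integral_prod) (auto simp: has_bochner_integral_iff)
  ultimately show "has_bochner_integral gauss (\<lambda>x. exp (gauss_vec x \<bullet> y)) (exp ((norm y)\<^sup>2 / 2))"
    by (simp add: has_bochner_integral_iff e ey)
  have "has_bochner_integral gauss (\<lambda>x. (x c)\<^sup>2 * exp (gauss_vec x \<bullet> y))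
           ((1 + (y \<bullet> c)\<^sup>2) * exp ((norm y)\<^sup>2 / 2))" if c: "c \<in> Basis" for c
  proof -
    \<comment> \<open>\<open>F\<close> lists the one-dimensional factors, with the square attached
      to coordinate \<open>c\<close> only; \<open>J\<close> lists their integrals.\<close>
    define F where "F b t = (if b = c then t\<^sup>2 * exp ((y \<bullet> b) * t) else exp ((y \<bullet> b) * t))" for b t
    define J where "J b = (if b = c then (1 + (y \<bullet> b)\<^sup>2) * exp ((y \<bullet> b)\<^sup>2 / 2) else exp ((y \<bullet> b)\<^sup>2 / 2))" for b
    have FJ: "has_bochner_integral (density lborel std_normal_density) (F b) (J b)" for b
      using std_normal_mgf by (cases "b = c") (simp_all add: F_def[abs_def] J_def)
    have eF: "(x c)\<^sup>2 * exp (gauss_vec x \<bullet> y) = (\<Prod>b\<in>Basis. F b (x b))" for x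
    proof -
      have "(\<Prod>b\<in>Basis - {c}. exp ((y \<bullet> b) * x b)) = (\<Prod>b\<in>Basis - {c}. F b (x b))"
        by (intro prod.cong) (auto simp: F_def)
      thus ?thesis using c
        by (simp add: e prod.remove[of Basis c] F_def mult.assoc)
    qed
    have eJ: "(1 + (y \<bullet> c)\<^sup>2) * exp ((norm y)\<^sup>2 / 2) = (\<Prod>b\<in>Basis. J b)"
    proof -
      have "(\<Prod>b\<in>Basis - {c}. exp ((y \<bullet> b)\<^sup>2 / 2)) = (\<Prod>b\<in>Basis - {c}. J b)"
        by (intro prod.cong) (auto simp: J_def)
      thus ?thesis using c
        by (simp add: ey prod.remove[of Basis c] J_def mult.assoc)
    qed
    have "integrable gauss (\<lambda>x. \<Prod>b\<in>Basis. F b (x b))"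
      unfolding gauss_def using FJ
      by (intro product_integrable_prod) (auto simp: has_bochner_integral_iff)
    moreover have "(\<integral>x. (\<Prod>b\<in>Basis. F b (x b)) \<partial>gauss) = (\<Prod>b\<in>Basis. J b)"
      unfolding gauss_def using FJ
      by (subst product_integral_prod) (auto simp: has_bochner_integral_iff)
    ultimately show ?thesis by (simp add: has_bochner_integral_iff eF eJ)
  qed
  hence "has_bochner_integral gauss (\<lambda>x. \<Sum>c\<in>Basis. (x c)\<^sup>2 * exp (gauss_vec x \<bullet> y))
      (\<Sum>c\<in>Basis. (1 + (y \<bullet> c)\<^sup>2) * exp ((norm y)\<^sup>2 / 2))"
    by (intro has_bochner_integral_sum)
  thus "has_bochner_integral gauss (\<lambda>x. (norm (gauss_vec x))\<^sup>2 * exp (gauss_vec x \<bullet> y))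
           ((DIM('a) + (norm y)\<^sup>2) * exp ((norm y)\<^sup>2 / 2))"
    by (simp add: norm_gauss_vec sum.distrib ny flip: sum_distrib_right)
qed

lemma gauss_exp_norm_square:
  assumes "\<sigma> < 1"
  shows "(\<integral>\<^sup>+x. ennreal (exp (\<sigma> * (norm (gauss_vec x :: 'a::euclidean_space))\<^sup>2 / 2)) \<partial>gauss)
     = ennreal ((1 / sqrt (1 - \<sigma>)) ^ DIM('a))"
proof -
  interpret N: prob_space "density lborel std_normal_density" by (rule prob_space_std_normal)
  interpret product_sigma_finite "\<lambda>b::'a. density lborel std_normal_density" ..
  have "ennreal (exp (\<sigma> * (norm (gauss_vec x :: 'a))\<^sup>2 / 2)) = (\<Prod>b\<in>Basis. ennreal (exp (\<sigma> * (x b)\<^sup>2 / 2)))" for x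
    by (simp add: norm_gauss_vec sum_distrib_left sum_divide_distrib exp_sum prod_ennreal)
  hence "(\<integral>\<^sup>+x. ennreal (exp (\<sigma> * (norm (gauss_vec x :: 'a))\<^sup>2 / 2)) \<partial>gauss)
      = (\<Prod>b\<in>(Basis::'a set). \<integral>\<^sup>+t. ennreal (exp (\<sigma> * t\<^sup>2 / 2)) \<partial>density lborel std_normal_density)"
    unfolding gauss_def by (simp add: product_nn_integral_prod[of Basis "\<lambda>_ t. ennreal (exp (\<sigma> * t\<^sup>2 / 2))"])
  thus ?thesis using assms by (simp add: std_normal_exp_square ennreal_power)
qed

lemma cosh_mono_abs: "\<bar>x\<bar> \<le> \<bar>y\<bar> \<Longrightarrow> cosh x \<le> cosh (y::real)"
  by (metis abs_ge_zero cosh_real_abs cosh_real_nonneg_le_iff)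

text \<open>The coercion to \<open>ennreal\<close> cuts negative values of \<open>f\<close> off at
  zero, which can only enlarge the integral.\<close>

lemma ennreal_integral_le_nn_integral:
  fixes f :: "'a \<Rightarrow> real"
  assumes "integrable M f"
  shows "ennreal (integral\<^sup>L M f) \<le> (\<integral>\<^sup>+x. ennreal (f x) \<partial>M)"
proof -
  have "ennreal (integral\<^sup>L M f) \<le> ennreal (\<integral>x. max 0 (f x) \<partial>M)"
    using assms by (intro ennreal_leI integral_mono) auto
  also have "\<dots> = (\<integral>\<^sup>+x. ennreal (max 0 (f x)) \<partial>M)"
    using assms by (intro nn_integral_eq_integral[symmetric]) auto
  also have "\<dots> = (\<integral>\<^sup>+x. ennreal (f x) \<partial>M)" by (simp add: ennreal_max_0)
  finally show ?thesis .
qed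

text \<open>The indicator of the ball is bounded below by \<open>1 - s\<^sup>2 |G|\<^sup>2 / \<rho>\<^sup>2\<close>, whose tilted Gaussian
  expectation is explicit; using \<open>cosh\<close> instead of \<open>exp\<close> makes the integrand monotone along rays.\<close>

lemma gauss_truncated_cosh_lower:
  fixes y y0 :: "'a::euclidean_space"
  assumes \<rho>: "\<rho> > 0" and y: "y0 = c *\<^sub>R y" "0 \<le> c" "c \<le> 1"
  shows "(\<integral>\<^sup>+x. ennreal (cosh (s * (gauss_vec x \<bullet> y))) * indicator {x. s * norm (gauss_vec x) \<le> \<rho>} x \<partial>gauss)
    \<ge> ennreal (exp (s\<^sup>2 * (norm y0)\<^sup>2 / 2) * (1 - s\<^sup>2 * (DIM('a) + s\<^sup>2 * (norm y0)\<^sup>2) / \<rho>\<^sup>2))"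
proof -
  let ?w = "\<lambda>x. 1 - s\<^sup>2 * (norm (gauss_vec x :: 'a))\<^sup>2 / \<rho>\<^sup>2"
  let ?E = "exp (s\<^sup>2 * (norm y0)\<^sup>2 / 2)"
  let ?m = "DIM('a) + s\<^sup>2 * (norm y0)\<^sup>2"
  \<comment> \<open>The value depends on \<open>r\<close> only through its square, so averaging the
    cases \<open>r = s\<close> and \<open>r = - s\<close> yields the same value for
    \<open>cosh\<close>.\<close>
  have *: "has_bochner_integral gauss (\<lambda>x. exp (r * (gauss_vec x \<bullet> y0)) - s\<^sup>2 / \<rho>\<^sup>2 * ((norm (gauss_vec x))\<^sup>2 * exp (r * (gauss_vec x \<bullet> y0))))
     (?E - s\<^sup>2 / \<rho>\<^sup>2 * (?m * ?E))" if "r = s \<or> r = - s" for r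
  proof -
    have "(norm (r *\<^sub>R y0))\<^sup>2 = s\<^sup>2 * (norm y0)\<^sup>2" using that by (auto simp: power_mult_distrib)
    with gauss_mgf[of "r *\<^sub>R y0"] show ?thesis
      by (intro has_bochner_integral_diff has_bochner_integral_mult_right) simp_all
  qed
  have I: "has_bochner_integral gauss (\<lambda>x. cosh (s * (gauss_vec x \<bullet> y0)) * ?w x) (?E * (1 - s\<^sup>2 * ?m / \<rho>\<^sup>2))"
    using has_bochner_integral_divide_zero[OF has_bochner_integral_add[OF *[of s] *[of "-s"]], of 2]
    by (rule has_bochner_integral_cong[THEN iffD1, rotated 3])
      (simp_all add: cosh_field_def diff_divide_distrib add_divide_distrib algebra_simps)
  hence "ennreal (?E * (1 - s\<^sup>2 * ?m / \<rho>\<^sup>2)) \<le> (\<integral>\<^sup>+x. ennreal (cosh (s * (gauss_vec x \<bullet> y0)) * ?w x) \<partial>gauss)"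
    using ennreal_integral_le_nn_integral[of gauss "\<lambda>x. cosh (s * (gauss_vec x \<bullet> y0)) * ?w x"]
    by (simp only: has_bochner_integral_iff)
  also have "\<dots> \<le> (\<integral>\<^sup>+x. ennreal (cosh (s * (gauss_vec x \<bullet> y))) * indicator {x. s * norm (gauss_vec x) \<le> \<rho>} x \<partial>gauss)"
  proof (rule nn_integral_mono)
    fix x :: "'a \<Rightarrow> real"
    have c: "cosh (s * (gauss_vec x \<bullet> y0)) \<le> cosh (s * (gauss_vec x \<bullet> y))"
      using y by (intro cosh_mono_abs) (simp add: abs_mult mult_left_le_one_le mult_left_mono)
    show "ennreal (cosh (s * (gauss_vec x \<bullet> y0)) * ?w x) \<le> ennreal (cosh (s * (gauss_vec x \<bullet> y))) * indicator {x. s * norm (gauss_vec x) \<le> \<rho>} x"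
    proof (cases "s * norm (gauss_vec x) \<le> \<rho>")
      case True
      have "cosh (s * (gauss_vec x \<bullet> y0)) * ?w x \<le> cosh (s * (gauss_vec x \<bullet> y0)) * 1"
        by (intro mult_left_mono) auto
      with c have "cosh (s * (gauss_vec x \<bullet> y0)) * ?w x \<le> cosh (s * (gauss_vec x \<bullet> y))" by linarith
      with True show ?thesis by (auto intro!: ennreal_leI)
    next
      case False
      hence "\<rho>\<^sup>2 \<le> (s * norm (gauss_vec x))\<^sup>2" using \<rho> by (intro power_mono) auto
      \<comment> \<open>Outside the ball the weight is nonpositive, so the zero of the indicator
        still dominates it.\<close>
      hence "?w x \<le> 0" using \<rho> by (simp add: power_mult_distrib)
      hence "cosh (s * (gauss_vec x \<bullet> y0)) * ?w x \<le> 0" by (intro mult_nonneg_nonpos) auto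
      with False show ?thesis by (simp add: ennreal_neg)
    qed
  qed
  finally show ?thesis .
qed


text \<open>A Markov argument for the truncated Gaussian average \<open>?I\<close> of
  \<open>cosh\<close>: on the event it is at least \<open>exp (2 * z) / 2\<close>, whereas its mean
  is at most \<open>exp z\<close> by Fubini and the moment bound \<open>mgf\<close>.\<close>

lemma subgaussian_norm_tail:
  fixes Y :: "'b \<Rightarrow> 'a::euclidean_space"
  assumes M: "prob_space M" and Y [measurable]: "Y \<in> borel_measurable M"
    and mgf: "\<And>\<gamma>. norm \<gamma> \<le> \<rho> \<Longrightarrow> (\<integral>\<^sup>+\<omega>. ennreal (exp (\<gamma> \<bullet> Y \<omega>)) \<partial>M) \<le> ennreal (exp ((norm \<gamma>)\<^sup>2 / 2))"
    and z: "z > 0" "4 * z \<le> \<rho>\<^sup>2" and \<rho>: "\<rho> > 0"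
  shows "measure M {\<omega> \<in> space M. norm (Y \<omega>) \<ge> 2 * (sqrt DIM('a) + sqrt (2 * z))} \<le> 2 * exp (- z)"
proof -
  interpret M: prob_space M by fact
  interpret G: prob_space "gauss :: ('a \<Rightarrow> real) measure" by (rule prob_space_gauss)
  interpret P: pair_sigma_finite "gauss :: ('a \<Rightarrow> real) measure" M ..
  define p where "p = real DIM('a)"
  have p: "p > 0" by (simp add: p_def)
  define A where "A = sqrt p + sqrt (2 * z)"
  have A: "A > 0" using p z by (simp add: A_def add_pos_pos)
  have A2: "A\<^sup>2 = p + 2 * z + 2 * (sqrt p * sqrt (2 * z))"
    using p z by (simp add: A_def power2_sum)
  have "0 \<le> sqrt p * sqrt (2 * z)" using p z by simp
  hence A2': "p + 2 * z \<le> A\<^sup>2" using A2 by simp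
  \<comment> \<open>The variance of the averaging Gaussian: \<open>\<sigma> (2A)\<^sup>2 = 4z\<close> makes the lower bound \<open>exp (2z) / 2\<close>,
    while \<open>p \<sigma> \<le> z\<close> keeps the upper bound below \<open>exp z\<close>.\<close>
  define \<sigma> where "\<sigma> = z / A\<^sup>2"
  have \<sigma>: "0 < \<sigma>" "\<sigma> \<le> 1/2" "p * \<sigma> \<le> z" "\<sigma> * A\<^sup>2 = z"
    using A z p A2' by (auto simp: \<sigma>_def field_simps)
  define s where "s = sqrt \<sigma>"
  have s: "s > 0" "s\<^sup>2 = \<sigma>" using \<sigma> by (auto simp: s_def)
  define E where "E = {\<omega> \<in> space M. norm (Y \<omega>) \<ge> 2 * A}"
  have E [measurable]: "E \<in> sets M" unfolding E_def by measurable
  let ?B = "{x :: 'a \<Rightarrow> real. s * norm (gauss_vec x :: 'a) \<le> \<rho>}"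
  let ?I = "\<lambda>\<omega>. \<integral>\<^sup>+x. ennreal (cosh (s * (gauss_vec x \<bullet> Y \<omega>))) * indicator ?B x \<partial>gauss"
  have lower: "ennreal (exp (2 * z) / 2) \<le> ?I \<omega>" if "\<omega> \<in> E" for \<omega>
  proof -
    \<comment> \<open>Shrinking \<open>Y \<omega>\<close> to norm exactly \<open>2 * A\<close> makes
      the Gaussian exponent equal to \<open>2 * z\<close>, however large \<open>Y \<omega>\<close>
      is.\<close>
    define c where "c = 2 * A / norm (Y \<omega>)"
    have nY: "norm (Y \<omega>) \<ge> 2 * A" using that by (simp add: E_def)
    hence c: "0 \<le> c" "c \<le> 1" using A by (auto simp: c_def divide_le_eq)
    have ny: "(norm (c *\<^sub>R Y \<omega>))\<^sup>2 = 4 * A\<^sup>2" using A nY by (auto simp: c_def power_mult_distrib)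
    have ny': "s\<^sup>2 * (norm (c *\<^sub>R Y \<omega>))\<^sup>2 = 4 * z" unfolding ny s(2) using \<sigma>(4) by simp
    \<comment> \<open>Here \<open>p + 4 * z \<le> 2 * (p + 2 * z) \<le> 2 * A\<^sup>2\<close>; with
      \<open>\<sigma> * A\<^sup>2 = z\<close> and \<open>4 * z \<le> \<rho>\<^sup>2\<close> the
      truncation loses at most half of the mass.\<close>
    have "\<sigma> * (p + 4 * z) \<le> \<sigma> * (2 * A\<^sup>2)" using A2' p \<sigma> by (intro mult_left_mono) auto
    also have "\<dots> \<le> \<rho>\<^sup>2 / 2" using \<sigma>(4) z by simp
    finally have "\<sigma> * (p + 4 * z) / \<rho>\<^sup>2 \<le> 1/2" using \<rho> by (simp add: field_simps)
    hence "exp (2 * z) * (1/2) \<le> exp (2 * z) * (1 - \<sigma> * (p + 4 * z) / \<rho>\<^sup>2)"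
      by (intro mult_left_mono) auto
    hence "ennreal (exp (2 * z) / 2) \<le> ennreal (exp (2 * z) * (1 - \<sigma> * (p + 4 * z) / \<rho>\<^sup>2))"
      by (intro ennreal_leI) simp
    also have "\<dots> \<le> ?I \<omega>"
      using gauss_truncated_cosh_lower[OF \<rho> refl c, of s "Y \<omega>"] unfolding ny' unfolding s(2)
      by (simp add: p_def)
    finally show ?thesis .
  qed
  have upper: "(\<integral>\<^sup>+\<omega>. ennreal (cosh (\<gamma> \<bullet> Y \<omega>)) \<partial>M) \<le> ennreal (exp ((norm \<gamma>)\<^sup>2 / 2))"
    if "norm \<gamma> \<le> \<rho>" for \<gamma>
  proof -
    have eq: "ennreal (cosh t) = ennreal (1/2) * (ennreal (exp t) + ennreal (exp (-t)))" for t :: real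
    proof -
      have "ennreal (cosh t) = ennreal (1/2 * (exp t + exp (-t)))" by (simp add: cosh_field_def)
      also have "\<dots> = ennreal (1/2) * ennreal (exp t + exp (-t))" by (rule ennreal_mult') simp
      finally show ?thesis by simp
    qed
    have "(\<integral>\<^sup>+\<omega>. ennreal (cosh (\<gamma> \<bullet> Y \<omega>)) \<partial>M)
      = ennreal (1/2) * ((\<integral>\<^sup>+\<omega>. ennreal (exp (\<gamma> \<bullet> Y \<omega>)) \<partial>M) + (\<integral>\<^sup>+\<omega>. ennreal (exp ((-\<gamma>) \<bullet> Y \<omega>)) \<partial>M))"
      unfolding eq by (simp add: nn_integral_cmult nn_integral_add)
    also have "\<dots> \<le> ennreal (1/2) * (ennreal (exp ((norm \<gamma>)\<^sup>2 / 2)) + ennreal (exp ((norm \<gamma>)\<^sup>2 / 2)))"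
      using mgf[OF that] mgf[of "-\<gamma>"] that by (intro mult_left_mono add_mono) auto
    also have "\<dots> = ennreal (1/2 * (exp ((norm \<gamma>)\<^sup>2 / 2) + exp ((norm \<gamma>)\<^sup>2 / 2)))"
      by (subst ennreal_mult', simp, subst ennreal_plus, simp_all)
    also have "\<dots> = ennreal (exp ((norm \<gamma>)\<^sup>2 / 2))" by simp
    finally show ?thesis .
  qed
  have meas: "(\<lambda>(x, \<omega>). ennreal (cosh (s * (gauss_vec x \<bullet> Y \<omega>))) * indicator ?B x)
      \<in> borel_measurable (gauss \<Otimes>\<^sub>M M)"
    unfolding cosh_field_def by measurable
  have "ennreal (exp (2 * z) / 2) * emeasure M E = (\<integral>\<^sup>+\<omega>. ennreal (exp (2 * z) / 2) * indicator E \<omega> \<partial>M)"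
    by (simp add: nn_integral_cmult_indicator)
  also have "\<dots> \<le> (\<integral>\<^sup>+\<omega>. ?I \<omega> \<partial>M)"
    using lower by (intro nn_integral_mono) (auto split: split_indicator)
  also have "\<dots> = (\<integral>\<^sup>+x. \<integral>\<^sup>+\<omega>. ennreal (cosh (s * (gauss_vec x \<bullet> Y \<omega>))) * indicator ?B x \<partial>M \<partial>gauss)"
    using meas by (rule P.Fubini')
  also have "\<dots> \<le> (\<integral>\<^sup>+x. ennreal (exp (\<sigma> * (norm (gauss_vec x :: 'a))\<^sup>2 / 2)) \<partial>gauss)"
  proof (rule nn_integral_mono)
    fix x :: "'a \<Rightarrow> real"
    show "(\<integral>\<^sup>+\<omega>. ennreal (cosh (s * (gauss_vec x \<bullet> Y \<omega>))) * indicator ?B x \<partial>M)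
      \<le> ennreal (exp (\<sigma> * (norm (gauss_vec x :: 'a))\<^sup>2 / 2))"
    proof (cases "x \<in> ?B")
      case True
      \<comment> \<open>The truncation serves exactly here: it keeps the direction in the ball of
        radius \<open>\<rho>\<close> where the moment bound is assumed.\<close>
      with upper[of "s *\<^sub>R gauss_vec x"] s show ?thesis by (simp add: power_mult_distrib)
    qed simp
  qed
  also have "\<dots> = ennreal ((1 / sqrt (1 - \<sigma>)) ^ DIM('a))"
    using \<sigma> by (intro gauss_exp_norm_square) simp
  also have "\<dots> \<le> ennreal (exp z)"
  proof (rule ennreal_leI)
    \<comment> \<open>Since \<open>\<sigma> \<le> 1/2\<close>, \<open>ln (1 - \<sigma>) \<ge> -
      \<sigma> - 2 * \<sigma>\<^sup>2 \<ge> - 2 * \<sigma>\<close>. Each coordinate thus contributes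
      at most \<open>exp \<sigma>\<close>, in total
      \<open>exp (p * \<sigma>) \<le> exp z\<close>.\<close>
    have "\<sigma> * \<sigma> \<le> \<sigma> * (1/2)" using \<sigma> by (intro mult_left_mono) auto
    hence "- 2 * \<sigma> \<le> ln (1 - \<sigma>)"
      using ln_one_minus_pos_lower_bound[OF less_imp_le[OF \<sigma>(1)] \<sigma>(2)] unfolding power2_eq_square by linarith
    hence "exp (- 2 * \<sigma>) \<le> 1 - \<sigma>" using \<sigma> by (subst (asm) ln_ge_iff) auto
    moreover have "exp (- 2 * \<sigma>) = (exp (- \<sigma>))\<^sup>2" by (simp add: power2_eq_square flip: exp_add)
    ultimately have "exp (- \<sigma>) \<le> sqrt (1 - \<sigma>)" by (simp add: real_le_rsqrt)
    hence "1 / sqrt (1 - \<sigma>) \<le> 1 / exp (- \<sigma>)" by (intro divide_left_mono) (use \<sigma> in auto)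
    hence "1 / sqrt (1 - \<sigma>) \<le> exp \<sigma>" by (simp add: exp_minus inverse_eq_divide)
    hence "(1 / sqrt (1 - \<sigma>)) ^ DIM('a) \<le> exp \<sigma> ^ DIM('a)" using \<sigma> by (intro power_mono) auto
    also have "\<dots> = exp (p * \<sigma>)" by (simp add: p_def exp_of_nat_mult)
    also have "\<dots> \<le> exp z" using \<sigma> by simp
    finally show "(1 / sqrt (1 - \<sigma>)) ^ DIM('a) \<le> exp z" .
  qed
  finally have "ennreal (exp (2 * z) / 2) * ennreal (measure M E) \<le> ennreal (exp z)"
    by (simp only: M.emeasure_eq_measure)
  hence "exp (2 * z) / 2 * measure M E \<le> exp z" by (simp flip: ennreal_mult')
  moreover have "exp (2 * z) = exp z * exp z" by (simp flip: exp_add)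
  ultimately have "exp z * measure M E \<le> 2" by simp
  hence "measure M E \<le> 2 * exp (- z)" by (simp add: exp_minus field_simps)
  thus ?thesis by (simp add: E_def A_def p_def)
qed

section \<open>Exponential families with bounded statistic\<close>

lemma exp_minus_one_le: "exp y - 1 \<le> y * exp (y::real)"
proof -
  have "exp y * (1 - y) \<le> exp y * exp (- y)"
    using exp_ge_add_one_self[of "-y"] by (intro mult_left_mono) auto
  thus ?thesis by (simp add: exp_minus algebra_simps)
qed

text \<open>Follows from \<open>exp y - 1 - y \<le> y * (exp y - 1)\<close> and \<open>\<bar>exp y -
  1\<bar> \<le> \<bar>y\<bar> * exp \<bar>y\<bar>\<close>. The constant is crude; the quadratic
  order is what differentiation under the integral requires.\<close>

lemma exp_taylor_remainder:
  fixes y :: real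
  shows "\<bar>exp y - 1 - y\<bar> \<le> y\<^sup>2 * exp \<bar>y\<bar>"
proof -
  note up = exp_minus_one_le[of y]
  have "\<bar>exp y - 1\<bar> \<le> \<bar>y\<bar> * exp \<bar>y\<bar>"
  proof (cases "y \<ge> 0")
    case False
    have "- y * 1 \<le> \<bar>y\<bar> * exp \<bar>y\<bar>" using False by (intro mult_mono) auto
    moreover have "\<bar>exp y - 1\<bar> = 1 - exp y" using False by auto
    ultimately show ?thesis using exp_ge_add_one_self[of y] by linarith
  qed (use up in simp)
  hence "\<bar>y\<bar> * \<bar>exp y - 1\<bar> \<le> \<bar>y\<bar> * (\<bar>y\<bar> * exp \<bar>y\<bar>)" by (intro mult_left_mono) auto
  moreover have "y * (exp y - 1) \<le> \<bar>y\<bar> * \<bar>exp y - 1\<bar>" by (metis abs_ge_self abs_mult)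
  ultimately show ?thesis
    using up exp_ge_add_one_self[of y] by (simp add: power2_eq_square algebra_simps)
qed

text \<open>In \<open>exp x + exp (- x)\<close> the odd Taylor terms cancel and the fourth-order
  Lagrange remainders are nonnegative.\<close>

lemma cosh_ge_quadratic: "1 + x\<^sup>2 / 2 \<le> cosh (x::real)"
proof -
  obtain s where s: "exp x = (\<Sum>m<4. x^m / fact m) + exp s / fact 4 * x^4"
    using Maclaurin_exp_le by blast
  obtain t where t: "exp (-x) = (\<Sum>m<4. (-x)^m / fact m) + exp t / fact 4 * (-x)^4"
    using Maclaurin_exp_le by blast
  have "exp x + exp (-x) = 2 + x\<^sup>2 + (exp s + exp t) / fact 4 * x^4"
    unfolding s t by (simp add: numeral_eq_Suc field_simps)
  moreover have "0 \<le> (exp s + exp t) / fact 4 * x^4"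
    by (intro mult_nonneg_nonneg divide_nonneg_nonneg add_nonneg_nonneg) auto
  ultimately show ?thesis by (simp add: cosh_field_def)
qed

section \<open>Differentiation under the integral sign\<close>

lemma (in finite_measure) integrable_bounded:
  fixes f :: "'a \<Rightarrow> real"
  assumes "f \<in> borel_measurable M" "\<And>x. \<bar>f x\<bar> \<le> C"
  shows "integrable M f"
  using assms by (intro integrable_const_bound[where B = C]) auto

text \<open>The difference quotient deviates from the claimed derivative by at most a constant times
  \<open>\<bar>\<eta>\<bar>\<close>: the second-order remainder of the exponential is bounded
  uniformly because \<open>q\<close>, \<open>a\<close> and \<open>b\<close> are bounded.\<close>

lemma (in finite_measure) has_derivative_exp_integral:
  fixes q a b :: "'a \<Rightarrow> real"
  assumes [measurable]: "q \<in> borel_measurable M" "a \<in> borel_measurable M" "b \<in> borel_measurable M"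
    and q: "\<And>x. \<bar>q x\<bar> \<le> C" and a: "\<And>x. \<bar>a x\<bar> \<le> C" and b: "\<And>x. \<bar>b x\<bar> \<le> C"
  shows "((\<lambda>t. \<integral>x. q x * exp (a x + t * b x) \<partial>M) has_real_derivative
      (\<integral>x. q x * b x * exp (a x + t * b x) \<partial>M)) (at t)"
proof -
  have C: "C \<ge> 0" using q by (meson abs_ge_zero order_trans)
  have ebd: "exp (a x + s * b x) \<le> exp (C + \<bar>s\<bar> * C)" for x s
  proof -
    have "s * b x \<le> \<bar>s\<bar> * \<bar>b x\<bar>" by (metis abs_ge_self abs_mult)
    also have "\<dots> \<le> \<bar>s\<bar> * C" using b by (intro mult_left_mono) auto
    finally show ?thesis using a[of x] by simp
  qed
  have int1: "integrable M (\<lambda>x. q x * exp (a x + s * b x))" for s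
    using q ebd C by (intro integrable_bounded[where C = "C * exp (C + \<bar>s\<bar> * C)"])
      (auto simp: abs_mult intro!: mult_mono)
  have int2: "integrable M (\<lambda>x. q x * b x * exp (a x + s * b x))" for s
    using q b ebd C by (intro integrable_bounded[where C = "C * C * exp (C + \<bar>s\<bar> * C)"])
      (auto simp: abs_mult intro!: mult_mono)
  let ?G = "\<lambda>t. \<integral>x. q x * exp (a x + t * b x) \<partial>M"
  let ?D = "\<integral>x. q x * b x * exp (a x + t * b x) \<partial>M"
  \<comment> \<open>The factors bound \<open>q\<close>, the exponential at \<open>t\<close>, and the
    remainder over \<open>\<eta>\<^sup>2\<close>; the last one uses
    \<open>\<bar>\<eta> * b x\<bar> \<le> C\<close> for
    \<open>\<bar>\<eta>\<bar> \<le> 1\<close>.\<close>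
  define B where "B = C * exp (C + \<bar>t\<bar> * C) * (C\<^sup>2 * exp C)"
  have est: "\<bar>(?G (t + \<eta>) - ?G t) / \<eta> - ?D\<bar> \<le> \<bar>\<eta>\<bar> * (B * measure M (space M))"
    if \<eta>: "\<eta> \<noteq> 0" "\<bar>\<eta>\<bar> \<le> 1" for \<eta>
  proof -
    let ?r = "\<lambda>x. q x * exp (a x + t * b x) * (exp (\<eta> * b x) - 1 - \<eta> * b x)"
    have r: "?r x = q x * exp (a x + (t + \<eta>) * b x) - q x * exp (a x + t * b x) - \<eta> * (q x * b x * exp (a x + t * b x))" for x
      by (simp add: algebra_simps exp_add)
    have rb: "\<bar>?r x\<bar> \<le> \<eta>\<^sup>2 * B" for x
    proof -
      have e1: "\<bar>\<eta> * b x\<bar> \<le> C"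
        using mult_mono[OF \<eta>(2) b[of x]] by (simp add: abs_mult)
      have "\<bar>exp (\<eta> * b x) - 1 - \<eta> * b x\<bar> \<le> (\<eta> * b x)\<^sup>2 * exp \<bar>\<eta> * b x\<bar>"
        by (rule exp_taylor_remainder)
      also have "\<dots> \<le> (\<eta>\<^sup>2 * C\<^sup>2) * exp C"
        using e1 b[of x] C by (auto simp: power_mult_distrib abs_le_square_iff[symmetric] intro!: mult_mono)
      finally have "\<bar>?r x\<bar> \<le> C * exp (C + \<bar>t\<bar> * C) * ((\<eta>\<^sup>2 * C\<^sup>2) * exp C)"
        unfolding abs_mult using q ebd C by (intro mult_mono) auto
      thus ?thesis by (simp add: B_def mult_ac)
    qed
    have intr: "integrable M ?r" unfolding r using int1 int2 by simp
    have "integral\<^sup>L M ?r = ?G (t + \<eta>) - ?G t - \<eta> * ?D"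
      unfolding r using int1 int2 by simp
    hence quot: "(?G (t + \<eta>) - ?G t) / \<eta> - ?D = integral\<^sup>L M ?r / \<eta>" using \<eta> by (simp add: field_simps)
    have "\<bar>integral\<^sup>L M ?r\<bar> \<le> \<eta>\<^sup>2 * B * measure M (space M)"
    proof -
      have "\<bar>integral\<^sup>L M ?r\<bar> \<le> (\<integral>x. \<bar>?r x\<bar> \<partial>M)" by (rule integral_abs_bound)
      also have "\<dots> \<le> (\<integral>x. \<eta>\<^sup>2 * B \<partial>M)" using intr rb by (intro integral_mono) auto
      finally show ?thesis by (simp add: mult_ac)
    qed
    hence "\<bar>integral\<^sup>L M ?r\<bar> / \<bar>\<eta>\<bar> \<le> \<eta>\<^sup>2 * B * measure M (space M) / \<bar>\<eta>\<bar>"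
      by (rule divide_right_mono) simp
    also have "\<dots> = \<eta>\<^sup>2 / \<bar>\<eta>\<bar> * (B * measure M (space M))" by simp
    also have "\<eta>\<^sup>2 / \<bar>\<eta>\<bar> = \<bar>\<eta>\<bar>" using \<eta> by (simp add: power2_eq_square divide_eq_eq)
    finally show ?thesis unfolding quot abs_divide .
  qed
  have "((\<lambda>\<eta>. (?G (t + \<eta>) - ?G t) / \<eta> - ?D) \<longlongrightarrow> 0) (at 0)"
  proof (rule Lim_null_comparison)
    show "\<forall>\<^sub>F \<eta> in at 0. norm ((?G (t + \<eta>) - ?G t) / \<eta> - ?D) \<le> \<bar>\<eta>\<bar> * (B * measure M (space M))"
      unfolding eventually_at using est by (intro exI[of _ 1]) auto
    show "((\<lambda>\<eta>. \<bar>\<eta>\<bar> * (B * measure M (space M))) \<longlongrightarrow> 0) (at 0)"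
      by (intro tendsto_mult_left_zero tendsto_rabs_zero tendsto_ident_at)
  qed
  thus ?thesis unfolding DERIV_def by (rule LIM_zero_cancel)
qed

lemma (in prob_space) subgaussian_second_moment_le:
  fixes X :: "'a \<Rightarrow> real"
  assumes [measurable]: "X \<in> borel_measurable M" and bd: "\<And>\<omega>. \<bar>X \<omega>\<bar> \<le> C" and "g > 0"
    and mgf: "\<And>s. \<bar>s\<bar> \<le> g \<Longrightarrow> expectation (\<lambda>\<omega>. exp (s * X \<omega>)) \<le> exp (\<nu>\<^sup>2 * s\<^sup>2 / 2)"
  shows "expectation (\<lambda>\<omega>. (X \<omega>)\<^sup>2) \<le> \<nu>\<^sup>2"
proof -
  have iexp: "integrable M (\<lambda>\<omega>. exp (s * X \<omega>))" for s
  proof (rule integrable_bounded[where C = "exp (\<bar>s\<bar> * C)"])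
    fix \<omega>
    have "s * X \<omega> \<le> \<bar>s\<bar> * \<bar>X \<omega>\<bar>" by (metis abs_ge_self abs_mult)
    also have "\<dots> \<le> \<bar>s\<bar> * C" using bd by (intro mult_left_mono) auto
    finally show "\<bar>exp (s * X \<omega>)\<bar> \<le> exp (\<bar>s\<bar> * C)" by simp
  qed measurable
  have isq: "integrable M (\<lambda>\<omega>. (X \<omega>)\<^sup>2)"
    using bd by (intro integrable_bounded[where C = "C\<^sup>2"]) (auto intro!: abs_le_square_iff[THEN iffD1] simp: order_trans[OF bd abs_ge_self])
  have bound: "expectation (\<lambda>\<omega>. (X \<omega>)\<^sup>2) \<le> \<nu>\<^sup>2 * exp (\<nu>\<^sup>2 * s\<^sup>2 / 2)" if s: "0 < s" "s \<le> g" for s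
  proof -
    have "1 + s\<^sup>2 / 2 * expectation (\<lambda>\<omega>. (X \<omega>)\<^sup>2) = expectation (\<lambda>\<omega>. 1 + s\<^sup>2 / 2 * (X \<omega>)\<^sup>2)"
      using isq by (simp add: prob_space)
    also have "\<dots> \<le> expectation (\<lambda>\<omega>. (exp (s * X \<omega>) + exp ((-s) * X \<omega>)) / 2)"
      using cosh_ge_quadratic[of "s * X _"] isq iexp[of s] iexp[of "-s"]
      by (intro integral_mono) (auto simp: cosh_field_def power_mult_distrib)
    also have "\<dots> = (expectation (\<lambda>\<omega>. exp (s * X \<omega>)) + expectation (\<lambda>\<omega>. exp ((-s) * X \<omega>))) / 2"
      using iexp[of s] iexp[of "-s"] by simp
    also have "\<dots> \<le> exp (\<nu>\<^sup>2 * s\<^sup>2 / 2)" using mgf[of s] mgf[of "-s"] s by simp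
    finally have 1: "1 + s\<^sup>2 / 2 * expectation (\<lambda>\<omega>. (X \<omega>)\<^sup>2) \<le> exp (\<nu>\<^sup>2 * s\<^sup>2 / 2)" .
    \<comment> \<open>Bounding \<open>exp y - 1\<close> by \<open>y * exp y\<close> puts a factor
      \<open>s\<^sup>2 / 2\<close> on the right, which then cancels.\<close>
    from 1 exp_minus_one_le[of "\<nu>\<^sup>2 * s\<^sup>2 / 2"]
    have "s\<^sup>2 / 2 * expectation (\<lambda>\<omega>. (X \<omega>)\<^sup>2) \<le> s\<^sup>2 / 2 * (\<nu>\<^sup>2 * exp (\<nu>\<^sup>2 * s\<^sup>2 / 2))"
      by (simp add: mult_ac)
    thus ?thesis using s by (simp add: mult_le_cancel_left)
  qed
  have "((\<lambda>s. \<nu>\<^sup>2 * exp (\<nu>\<^sup>2 * s\<^sup>2 / 2)) \<longlongrightarrow> \<nu>\<^sup>2 * exp (\<nu>\<^sup>2 * 0\<^sup>2 / 2)) (at_right 0)"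
    by (intro tendsto_intros) simp
  moreover have "\<forall>\<^sub>F s in at_right 0. expectation (\<lambda>\<omega>. (X \<omega>)\<^sup>2) \<le> \<nu>\<^sup>2 * exp (\<nu>\<^sup>2 * s\<^sup>2 / 2)"
    using \<open>g > 0\<close> bound by (auto simp: eventually_at_right[of 0 g])
  ultimately show ?thesis by (simp add: tendsto_lowerbound)
qed

text \<open>Models functions \<open>m \<bullet> \<theta> - c * (\<integral>t. exp (Psi t \<bullet>
  \<theta>) \<partial>\<mu>)\<close>. The likelihood and its expectation both have this form and
  differ only in the vector \<open>m\<close>, so one calculus serves both.\<close>

locale bounded_exp_family = finite_measure \<mu> for \<mu> :: "'t measure" +
  fixes Psi :: "'t \<Rightarrow> 'b::euclidean_space" and C :: real
  assumes Psi [measurable]: "Psi \<in> borel_measurable \<mu>" and Psi_bound: "\<And>t. norm (Psi t) \<le> C"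
begin

lemma inner_bound: "\<bar>Psi t \<bullet> v\<bar> \<le> C * norm v"
  using Cauchy_Schwarz_ineq2[of "Psi t" v] mult_right_mono[OF Psi_bound norm_ge_zero]
  by (rule order_trans)

lemma integrable_mult_exp:
  assumes [measurable]: "q \<in> borel_measurable \<mu>" and q: "\<And>t. \<bar>q t\<bar> \<le> c"
  shows "integrable \<mu> (\<lambda>t. q t * exp (Psi t \<bullet> \<theta>))"
proof (rule integrable_bounded[where C = "c * exp (C * norm \<theta>)"])
  fix t
  have "exp (Psi t \<bullet> \<theta>) \<le> exp (C * norm \<theta>)" using inner_bound[of t \<theta>] by simp
  thus "\<bar>q t * exp (Psi t \<bullet> \<theta>)\<bar> \<le> c * exp (C * norm \<theta>)"
    unfolding abs_mult using q[of t] by (intro mult_mono) (auto intro: order_trans[OF abs_ge_zero])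
qed measurable

lemma integrable_exp: "integrable \<mu> (\<lambda>t. exp (Psi t \<bullet> \<theta>))"
  using integrable_mult_exp[of "\<lambda>_. 1" 1 \<theta>] by simp

lemma integrable_inner_exp: "integrable \<mu> (\<lambda>t. (Psi t \<bullet> v) * exp (Psi t \<bullet> \<theta>))"
  by (rule integrable_mult_exp) (measurable, rule inner_bound)

lemma integrable_inner2_exp: "integrable \<mu> (\<lambda>t. (Psi t \<bullet> v) * (Psi t \<bullet> w) * exp (Psi t \<bullet> \<theta>))"
proof (rule integrable_mult_exp)
  show "\<bar>(Psi t \<bullet> v) * (Psi t \<bullet> w)\<bar> \<le> (C * norm v) * (C * norm w)" for t
    unfolding abs_mult using inner_bound[of t v] inner_bound[of t w]
    by (intro mult_mono) (auto intro: order_trans[OF abs_ge_zero])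
qed measurable

text \<open>With \<open>q\<close> constantly 1 this gives the directional derivative of the
  integral, and with \<open>q t = Psi t \<bullet> v\<close> the second one.\<close>

lemma deriv_mult_exp_line:
  assumes [measurable]: "q \<in> borel_measurable \<mu>" and q: "\<And>t. \<bar>q t\<bar> \<le> c"
  shows "((\<lambda>s. \<integral>t. q t * exp (Psi t \<bullet> (\<theta> + s *\<^sub>R v)) \<partial>\<mu>) has_real_derivative
      (\<integral>t. q t * (Psi t \<bullet> v) * exp (Psi t \<bullet> (\<theta> + s *\<^sub>R v)) \<partial>\<mu>)) (at s)"
  unfolding inner_add_right inner_scaleR_right
  by (rule has_derivative_exp_integral[where C = "max c (max (C * norm \<theta>) (C * norm v))"])
    (measurable, use q inner_bound in \<open>auto simp: le_max_iff_disj\<close>)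

text \<open>The derivative along the line through \<open>\<theta>s\<close> in direction
  \<open>v\<close> vanishes at \<open>s = 0\<close>.\<close>

lemma score_eq_at_maximizer:
  assumes max: "\<And>\<theta>. m \<bullet> \<theta> - c * (\<integral>t. exp (Psi t \<bullet> \<theta>) \<partial>\<mu>) \<le> m \<bullet> \<theta>s - c * (\<integral>t. exp (Psi t \<bullet> \<theta>s) \<partial>\<mu>)"
  shows "m \<bullet> v = c * (\<integral>t. (Psi t \<bullet> v) * exp (Psi t \<bullet> \<theta>s) \<partial>\<mu>)"
proof -
  let ?f = "\<lambda>s. m \<bullet> (\<theta>s + s *\<^sub>R v) - c * (\<integral>t. 1 * exp (Psi t \<bullet> (\<theta>s + s *\<^sub>R v)) \<partial>\<mu>)"
  have "(?f has_real_derivative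
      (m \<bullet> v - c * (\<integral>t. 1 * (Psi t \<bullet> v) * exp (Psi t \<bullet> (\<theta>s + 0 *\<^sub>R v)) \<partial>\<mu>))) (at 0)"
    by (intro DERIV_diff DERIV_cmult deriv_mult_exp_line[where c = 1])
      (auto simp: inner_add_right intro!: derivative_eq_intros)
  hence "m \<bullet> v - c * (\<integral>t. 1 * (Psi t \<bullet> v) * exp (Psi t \<bullet> (\<theta>s + 0 *\<^sub>R v)) \<partial>\<mu>) = 0"
    by (rule DERIV_local_max[where d = 1]) (use max in auto)
  thus ?thesis by simp
qed

text \<open>With \<open>G\<close> the derivative of the integral along the segment, concavity gives
  \<open>c * G s0 \<le> S \<bullet> v\<close> at the boundary point, and the curvature bound gives
  \<open>c * (G s0 - G 0) \<ge> \<kappa> * r * d\<close>. Adding the two yields the claim.\<close>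

lemma score_lower_bound_outside:
  assumes c: "c \<ge> 0" and D: "linear D" and r: "r \<ge> 0" and out: "r < norm (D (\<theta>t - \<theta>s))"
    and max: "\<And>\<theta>. S \<bullet> \<theta> - c * (\<integral>t. exp (Psi t \<bullet> \<theta>) \<partial>\<mu>) \<le> S \<bullet> \<theta>t - c * (\<integral>t. exp (Psi t \<bullet> \<theta>t) \<partial>\<mu>)"
    and curv: "\<And>\<theta>. norm (D (\<theta> - \<theta>s)) \<le> r \<Longrightarrow>
       \<kappa> * (norm (D (\<theta>t - \<theta>s)))\<^sup>2 \<le> c * (\<integral>t. (Psi t \<bullet> (\<theta>t - \<theta>s)) * (Psi t \<bullet> (\<theta>t - \<theta>s)) * exp (Psi t \<bullet> \<theta>) \<partial>\<mu>)"
  shows "\<kappa> * r * norm (D (\<theta>t - \<theta>s))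
    \<le> S \<bullet> (\<theta>t - \<theta>s) - c * (\<integral>t. (Psi t \<bullet> (\<theta>t - \<theta>s)) * exp (Psi t \<bullet> \<theta>s) \<partial>\<mu>)"
proof -
  define v where "v = \<theta>t - \<theta>s"
  define d where "d = norm (D v)"
  have d: "r < d" "d > 0" using out r by (auto simp: d_def v_def)
  \<comment> \<open>The parameter at which the segment from \<open>\<theta>s\<close> to
    \<open>\<theta>t\<close> leaves the ball of radius \<open>r\<close>.\<close>
  define s0 where "s0 = r / d"
  have s0: "0 \<le> s0" "s0 < 1" "s0 * d = r" using d r by (auto simp: s0_def)
  define \<theta> where "\<theta> s = \<theta>s + s *\<^sub>R v" for s
  define G where "G s = (\<integral>t. (Psi t \<bullet> v) * exp (Psi t \<bullet> \<theta> s) \<partial>\<mu>)" for s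
  have \<theta>1: "\<theta>t = \<theta> s0 + (1 - s0) *\<^sub>R v" by (simp add: \<theta>_def v_def algebra_simps)
  \<comment> \<open>The tangent of the exponential at \<open>\<theta> s0\<close> lies below its
    value at \<open>\<theta>t\<close>; integrated, this is the convexity of the subtracted
    term.\<close>
  have "(1 - s0) * G s0 = (\<integral>t. (1 - s0) * ((Psi t \<bullet> v) * exp (Psi t \<bullet> \<theta> s0)) \<partial>\<mu>)"
    by (simp add: G_def)
  also have "\<dots> \<le> (\<integral>t. exp (Psi t \<bullet> \<theta>t) - exp (Psi t \<bullet> \<theta> s0) \<partial>\<mu>)"
  proof (rule integral_mono)
    fix t
    let ?y = "(1 - s0) * (Psi t \<bullet> v)"
    have "exp (Psi t \<bullet> \<theta> s0) * (1 + ?y) \<le> exp (Psi t \<bullet> \<theta> s0) * exp ?y"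
      by (intro mult_left_mono exp_ge_add_one_self) auto
    also have "\<dots> = exp (Psi t \<bullet> \<theta>t)" unfolding \<theta>1 by (simp add: inner_add_right exp_add)
    finally show "(1 - s0) * ((Psi t \<bullet> v) * exp (Psi t \<bullet> \<theta> s0)) \<le> exp (Psi t \<bullet> \<theta>t) - exp (Psi t \<bullet> \<theta> s0)"
      by (simp add: algebra_simps)
  qed (use integrable_exp integrable_inner_exp in auto)
  also have "\<dots> = (\<integral>t. exp (Psi t \<bullet> \<theta>t) \<partial>\<mu>) - (\<integral>t. exp (Psi t \<bullet> \<theta> s0) \<partial>\<mu>)"
    using integrable_exp by simp
  finally have "c * ((1 - s0) * G s0) \<le> c * ((\<integral>t. exp (Psi t \<bullet> \<theta>t) \<partial>\<mu>) - (\<integral>t. exp (Psi t \<bullet> \<theta> s0) \<partial>\<mu>))"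
    using c by (rule mult_left_mono)
  also have "\<dots> \<le> S \<bullet> \<theta>t - S \<bullet> \<theta> s0" using max[of "\<theta> s0"] by (simp add: algebra_simps)
  also have "\<dots> = (1 - s0) * (S \<bullet> v)" unfolding \<theta>1 by (simp add: inner_add_right)
  finally have "(1 - s0) * (c * G s0) \<le> (1 - s0) * (S \<bullet> v)" by (simp add: mult_ac)
  hence SG: "c * G s0 \<le> S \<bullet> v" using s0 by (simp add: mult_le_cancel_left)
  \<comment> \<open>Subtracting the linear function \<open>\<kappa> * d\<^sup>2 * s\<close> turns
    the curvature bound into monotonicity on \<open>[0, s0]\<close>, the part of the segment inside
    the ball.\<close>
  have "c * G 0 - \<kappa> * d\<^sup>2 * 0 \<le> c * G s0 - \<kappa> * d\<^sup>2 * s0"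
  proof (rule DERIV_nonneg_imp_nondecreasing[OF s0(1)])
    fix s assume s: "0 \<le> s" "s \<le> s0"
    have "s * d \<le> s0 * d" using s d by (intro mult_right_mono) auto
    hence "norm (D (\<theta> s - \<theta>s)) \<le> r" using s s0 by (simp add: \<theta>_def d_def linear_scale[OF D])
    from curv[OF this] have "0 \<le> c * (\<integral>t. (Psi t \<bullet> v) * (Psi t \<bullet> v) * exp (Psi t \<bullet> \<theta> s) \<partial>\<mu>) - \<kappa> * d\<^sup>2"
      by (simp add: v_def d_def)
    moreover have "((\<lambda>s. c * G s - \<kappa> * d\<^sup>2 * s) has_real_derivative
        (c * (\<integral>t. (Psi t \<bullet> v) * (Psi t \<bullet> v) * exp (Psi t \<bullet> \<theta> s) \<partial>\<mu>) - \<kappa> * d\<^sup>2)) (at s)"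
      unfolding G_def \<theta>_def
      by (intro DERIV_diff DERIV_cmult deriv_mult_exp_line[where c = "C * norm v"])
        (auto simp: inner_bound intro!: derivative_eq_intros)
    ultimately show "\<exists>y. ((\<lambda>s. c * G s - \<kappa> * d\<^sup>2 * s) has_real_derivative y) (at s) \<and> 0 \<le> y" by blast
  qed
  moreover have "\<kappa> * d\<^sup>2 * s0 = \<kappa> * r * d" using s0(3) by (simp add: power2_eq_square mult_ac)
  ultimately have "\<kappa> * r * d \<le> S \<bullet> v - c * G 0" using SG by simp
  thus ?thesis by (simp add: G_def \<theta>_def d_def v_def)
qed

end

section \<open>The local likelihood\<close>

lemma borel_measurable_vec_nth [measurable (raw)]:
  fixes f :: "'a \<Rightarrow> real^'n"
  assumes [measurable]: "f \<in> borel_measurable M"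
  shows "(\<lambda>x. f x $ j) \<in> borel_measurable M"
proof -
  have "(\<lambda>x. f x \<bullet> axis j 1) \<in> borel_measurable M" by measurable
  thus ?thesis by (simp add: inner_axis)
qed

lemma cube_measurable [measurable]: "(cube :: (real^'d) set) \<in> sets borel"
proof -
  have "closed (cube :: (real^'d) set)" unfolding cube_def
    by (intro closed_Collect_all closed_Collect_le continuous_intros)
  thus ?thesis by simp
qed

lemma emeasure_cube_finite: "emeasure lborel (cube :: (real^'d) set) < \<infinity>"
proof (rule emeasure_bounded_finite)
  have "norm t \<le> CARD('d)" if "t \<in> cube" for t :: "real^'d"
  proof -
    have "norm t \<le> (\<Sum>i\<in>UNIV. \<bar>t $ i\<bar>)" by (rule norm_le_l1_cart)
    also have "\<dots> \<le> (\<Sum>i\<in>(UNIV::'d set). 1)" using that by (intro sum_mono) (auto simp: cube_def)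
    finally show ?thesis by simp
  qed
  thus "bounded (cube :: (real^'d) set)" unfolding bounded_iff by blast
qed

text \<open>Absorbing the kernel and the cube into the measure leaves integrands in
  \<open>Psi\<close> alone and makes the total mass finite.\<close>

definition kernel_measure :: "(real^'d \<Rightarrow> real) \<Rightarrow> (real^'d) measure" where
  "kernel_measure K = density lborel (\<lambda>t. ennreal (indicator cube t * K t))"

lemma measurable_kernel_measure [simp]:
  "borel_measurable (kernel_measure K) = borel_measurable lborel"
  by (rule measurable_cong_sets) (simp_all add: kernel_measure_def)

lemma finite_kernel_measure:
  fixes K :: "real^'d \<Rightarrow> real"
  assumes [measurable]: "K \<in> borel_measurable lborel" and K: "\<And>t. K t \<le> c"
  shows "finite_measure (kernel_measure K)"
proof (rule finite_measureI)
  have "emeasure (kernel_measure K) (space (kernel_measure K))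
      = (\<integral>\<^sup>+t. ennreal (indicator cube t * K t) \<partial>lborel)"
    by (simp add: kernel_measure_def emeasure_density)
  also have "\<dots> \<le> (\<integral>\<^sup>+t. ennreal c * indicator cube (t :: real^'d) \<partial>lborel)"
    using K by (intro nn_integral_mono) (auto split: split_indicator intro!: ennreal_leI)
  also have "\<dots> = ennreal c * emeasure lborel (cube :: (real^'d) set)" by (simp add: nn_integral_cmult_indicator)
  also have "\<dots> < \<infinity>" using emeasure_cube_finite[where 'd = 'd] by (simp add: ennreal_mult_less_top)
  finally show "emeasure (kernel_measure K) (space (kernel_measure K)) \<noteq> \<infinity>" by simp
qed

lemma integral_kernel_measure:
  assumes [measurable]: "K \<in> borel_measurable lborel" "F \<in> borel_measurable lborel"
    and K: "\<And>t. K t \<ge> 0"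
  shows "(LINT t:cube|lborel. K t * F t) = (\<integral>t. F t \<partial>kernel_measure K)"
  unfolding kernel_measure_def set_lebesgue_integral_def
  by (subst integral_density) (auto simp: K mult.assoc)

locale local_kernel =
  fixes K :: "real^'d \<Rightarrow> real" and Psi :: "real^'d \<Rightarrow> real^'p" and CK CP :: real
  assumes K [measurable]: "K \<in> borel_measurable lborel"
    and K_nonneg: "\<And>t. K t \<ge> 0" and K_bound: "\<And>t. K t \<le> CK"
    and Psi_lborel [measurable]: "Psi \<in> borel_measurable lborel"
    and Psi_norm: "\<And>t. norm (Psi t) \<le> CP"

sublocale local_kernel \<subseteq> bounded_exp_family "kernel_measure K" Psi CP
proof -
  interpret finite_measure "kernel_measure K" using K K_bound by (rule finite_kernel_measure)
  show "bounded_exp_family (kernel_measure K) Psi CP"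
    by standard (simp_all add: Psi_norm Psi_lborel)
qed

context local_kernel
begin

lemma integral_kernel:
  "F \<in> borel_measurable lborel \<Longrightarrow> (LINT t:cube|lborel. K t * F t) = (\<integral>t. F t \<partial>kernel_measure K)"
  using K K_nonneg by (intro integral_kernel_measure)

text \<open>The sufficient statistic: the only way in which the data enter the likelihood.\<close>

definition score_stat :: "real \<Rightarrow> real^'d \<Rightarrow> (nat \<Rightarrow> 'a \<Rightarrow> real^'d) \<Rightarrow> nat \<Rightarrow> 'a \<Rightarrow> real^'p" where
  "score_stat h x0 X n \<omega> = (\<Sum>i<n. K ((1/h) *\<^sub>R (X i \<omega> - x0)) *\<^sub>R Psi ((1/h) *\<^sub>R (X i \<omega> - x0)))"

lemma loglik_eq:
  "loglik K Psi h x0 X n \<omega> \<theta> = score_stat h x0 X n \<omega> \<bullet> \<theta>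
     - real n * h ^ CARD('d) * (\<integral>t. exp (Psi t \<bullet> \<theta>) \<partial>kernel_measure K)"
  unfolding loglik_def score_stat_def by (subst integral_kernel) (simp_all add: inner_sum_left)

lemma loglik_grad_inner:
  "loglik_grad K Psi h x0 X n \<omega> \<theta> \<bullet> v = score_stat h x0 X n \<omega> \<bullet> v
     - real n * h ^ CARD('d) * (\<integral>t. (Psi t \<bullet> v) * exp (Psi t \<bullet> \<theta>) \<partial>kernel_measure K)"
proof -
  have "(\<chi> j. LINT t:cube|lborel. K t * Psi t $ j * exp (Psi t \<bullet> \<theta>)) \<bullet> v
      = (\<Sum>j\<in>UNIV. (\<integral>t. Psi t $ j * exp (Psi t \<bullet> \<theta>) \<partial>kernel_measure K) * v $ j)"
    unfolding inner_vec_def[of _ v] mult.assoc by (simp add: integral_kernel)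
  also have "\<dots> = (\<integral>t. (\<Sum>j\<in>UNIV. Psi t $ j * exp (Psi t \<bullet> \<theta>) * v $ j) \<partial>kernel_measure K)"
    using integrable_inner_exp[of "axis _ 1" \<theta>] by (subst Bochner_Integration.integral_sum) (auto simp: inner_axis)
  also have "\<dots> = (\<integral>t. (Psi t \<bullet> v) * exp (Psi t \<bullet> \<theta>) \<partial>kernel_measure K)"
    by (simp add: inner_vec_def sum_distrib_left sum_distrib_right mult_ac)
  finally show ?thesis
    by (simp add: loglik_grad_def score_stat_def inner_diff_left)
qed

text \<open>The right-hand side for \<open>v = w\<close> is the negative second directional
  derivative of the likelihood, the form in which the curvature hypothesis of the abstract family is
  stated.\<close>

lemma Dsq_inner:
  "v \<bullet> (Dsq K Psi h n \<theta> *v w)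
     = real n * h ^ CARD('d) * (\<integral>t. (Psi t \<bullet> v) * (Psi t \<bullet> w) * exp (Psi t \<bullet> \<theta>) \<partial>kernel_measure K)"
proof -
  let ?c = "real n * h ^ CARD('d)"
  have int: "integrable (kernel_measure K) (\<lambda>t. Psi t $ j * Psi t $ k * exp (Psi t \<bullet> \<theta>))" for j k
    using integrable_inner2_exp[of "axis j 1" "axis k 1" \<theta>] by (simp add: inner_axis)
  have e: "Dsq K Psi h n \<theta> $ j $ k = ?c * (\<integral>t. Psi t $ j * Psi t $ k * exp (Psi t \<bullet> \<theta>) \<partial>kernel_measure K)" for j k
    unfolding Dsq_def mult.assoc by (simp add: integral_kernel)
  have "v \<bullet> (Dsq K Psi h n \<theta> *v w)
      = ?c * (\<Sum>j\<in>UNIV. \<Sum>k\<in>UNIV. \<integral>t. v $ j * w $ k * (Psi t $ j * Psi t $ k * exp (Psi t \<bullet> \<theta>)) \<partial>kernel_measure K)"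
    by (simp add: inner_vec_def matrix_vector_mult_def e sum_distrib_left mult_ac)
  also have "(\<Sum>j\<in>UNIV. \<Sum>k\<in>UNIV. \<integral>t. v $ j * w $ k * (Psi t $ j * Psi t $ k * exp (Psi t \<bullet> \<theta>)) \<partial>kernel_measure K)
      = (\<integral>t. (\<Sum>j\<in>UNIV. \<Sum>k\<in>UNIV. v $ j * w $ k * (Psi t $ j * Psi t $ k * exp (Psi t \<bullet> \<theta>))) \<partial>kernel_measure K)"
    using int by (simp add: Bochner_Integration.integral_sum)
  also have "\<dots> = (\<integral>t. (Psi t \<bullet> v) * (Psi t \<bullet> w) * exp (Psi t \<bullet> \<theta>) \<partial>kernel_measure K)"
    unfolding inner_vec_def[of "Psi _" v] inner_vec_def[of "Psi _" w] sum_product sum_distrib_right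
    by (simp add: sum_distrib_left mult_ac)
  finally show ?thesis .
qed

lemma score_stat_bound: "norm (score_stat h x0 X n \<omega>) \<le> real n * (CK * CP)"
proof -
  have "norm (score_stat h x0 X n \<omega>) \<le> (\<Sum>i<n. CK * CP)"
    unfolding score_stat_def
  proof (rule sum_norm_le)
    fix i
    show "norm (K ((1/h) *\<^sub>R (X i \<omega> - x0)) *\<^sub>R Psi ((1/h) *\<^sub>R (X i \<omega> - x0))) \<le> CK * CP"
      using K_nonneg K_bound Psi_norm by (auto intro!: mult_mono order_trans[OF K_nonneg K_bound])
  qed
  thus ?thesis by simp
qed

lemma score_stat_measurable:
  assumes "\<And>i. i < n \<Longrightarrow> X i \<in> borel_measurable M"
  shows "score_stat h x0 X n \<in> borel_measurable M"
proof -
  have [measurable]: "K \<in> borel_measurable borel" "Psi \<in> borel_measurable borel"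
    using K Psi_lborel by simp_all
  have "(\<lambda>\<omega>. \<Sum>i<n. K ((1/h) *\<^sub>R (X i \<omega> - x0)) *\<^sub>R Psi ((1/h) *\<^sub>R (X i \<omega> - x0))) \<in> borel_measurable M"
  proof (rule borel_measurable_sum)
    fix i assume "i \<in> {..<n}"
    hence [measurable]: "X i \<in> borel_measurable M" using assms by simp
    show "(\<lambda>\<omega>. K ((1/h) *\<^sub>R (X i \<omega> - x0)) *\<^sub>R Psi ((1/h) *\<^sub>R (X i \<omega> - x0))) \<in> borel_measurable M"
      by measurable
  qed
  thus ?thesis by (simp add: score_stat_def[abs_def])
qed

end

lemma cov_mat_quadratic_centered:
  fixes Y :: "'a \<Rightarrow> real^'p"
  assumes M: "prob_space M" and [measurable]: "Y \<in> borel_measurable M" and bd: "\<And>\<omega>. norm (Y \<omega>) \<le> c"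
    and centered: "\<And>j. integral\<^sup>L M (\<lambda>\<omega>. Y \<omega> $ j) = 0"
  shows "w \<bullet> (cov_mat M Y *v w) = integral\<^sup>L M (\<lambda>\<omega>. (w \<bullet> Y \<omega>)\<^sup>2)"
proof -
  interpret prob_space M by fact
  have int: "integrable M (\<lambda>\<omega>. Y \<omega> $ j * Y \<omega> $ k)" for j k
  proof (rule integrable_bounded[where C = "c * c"])
    fix \<omega>
    have "\<bar>Y \<omega> $ i\<bar> \<le> c" for i using component_le_norm_cart[of "Y \<omega>" i] bd[of \<omega>] by linarith
    thus "\<bar>Y \<omega> $ j * Y \<omega> $ k\<bar> \<le> c * c" unfolding abs_mult by (intro mult_mono) (auto intro: order_trans[OF abs_ge_zero])
  qed measurable
  have "w \<bullet> (cov_mat M Y *v w) = (\<Sum>j\<in>UNIV. \<Sum>k\<in>UNIV. expectation (\<lambda>\<omega>. w $ j * w $ k * (Y \<omega> $ j * Y \<omega> $ k)))"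
    by (simp add: inner_vec_def matrix_vector_mult_def cov_mat_def centered sum_distrib_left mult_ac)
  also have "\<dots> = expectation (\<lambda>\<omega>. \<Sum>j\<in>UNIV. \<Sum>k\<in>UNIV. w $ j * w $ k * (Y \<omega> $ j * Y \<omega> $ k))"
    using int by (simp add: Bochner_Integration.integral_sum)
  also have "\<dots> = expectation (\<lambda>\<omega>. (w \<bullet> Y \<omega>)\<^sup>2)"
    unfolding inner_vec_def power2_eq_square sum_product by (simp add: mult_ac)
  finally show ?thesis .
qed

theorem theorem1:
  fixes M :: "'a measure"
    and X :: "nat \<Rightarrow> 'a \<Rightarrow> real^'d"
    and f :: "real^'d \<Rightarrow> ennreal"
    and n :: nat and h :: real and x0 :: "real^'d"
    and K :: "real^'d \<Rightarrow> real"
    and Psi :: "real^'d \<Rightarrow> real^'p"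
    and \<theta>tilde :: "'a \<Rightarrow> real^'p"
    and \<theta>star :: "real^'p"
    and a \<nu>0 g z \<delta> :: real
  assumes M: "prob_space M"
    and n: "n \<ge> 1" and h: "h > 0"
    and indep: "prob_space.indep_vars M (\<lambda>_. borel) X {..<n}"
    and distr: "\<And>i. i < n \<Longrightarrow> distributed M lborel (X i) f"
    and K_meas: "K \<in> borel_measurable lborel"
    and K_nonneg: "\<And>t. K t \<ge> 0"
    and K_bdd: "bounded (range K)"
    and K_supp: "\<And>t. t \<notin> cube \<Longrightarrow> K t = 0"
    and Psi_meas: "Psi \<in> borel_measurable lborel"
    and Psi_bdd: "bounded (range Psi)"
    and Psi_supp: "\<And>t. t \<notin> cube \<Longrightarrow> Psi t = 0"
    and Psi0: "\<exists>j0. \<forall>t\<in>cube. Psi t $ j0 = 1"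
    and Psi_indep: "\<And>c. (\<forall>t. K t > 0 \<longrightarrow> c \<bullet> Psi t = 0) \<Longrightarrow> c = 0"
    and MLE: "\<And>\<omega> \<theta>. \<omega> \<in> space M \<Longrightarrow>
               loglik K Psi h x0 X n \<omega> \<theta> \<le> loglik K Psi h x0 X n \<omega> (\<theta>tilde \<omega>)"
    and MLE_meas: "\<theta>tilde \<in> borel_measurable M"
    and target: "\<And>\<theta>. integral\<^sup>L M (\<lambda>\<omega>. loglik K Psi h x0 X n \<omega> \<theta>)
                     \<le> integral\<^sup>L M (\<lambda>\<omega>. loglik K Psi h x0 X n \<omega> \<theta>star)"
    and V_pd: "pos_def_mat (cov_mat M (\<lambda>\<omega>. loglik_grad K Psi h x0 X n \<omega> \<theta>star))"
    and pos_params: "a > 0" "\<nu>0 > 0" "g > 0" "\<delta> \<ge> 0"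
    and z: "z > 0" "z \<le> g\<^sup>2 / 4"
    and cond_I: "loewner_le (cov_mat M (\<lambda>\<omega>. loglik_grad K Psi h x0 X n \<omega> \<theta>star))
                            (a\<^sup>2 *\<^sub>R Dsq K Psi h n \<theta>star)"
    and cond_ED0: "\<And>\<gamma> lam. \<gamma> \<noteq> 0 \<Longrightarrow> \<bar>lam\<bar> \<le> g \<Longrightarrow>
         (let Vinv = matrix_inv (msqrt (cov_mat M (\<lambda>\<omega>. loglik_grad K Psi h x0 X n \<omega> \<theta>star)));
              \<zeta> = (\<lambda>\<omega>. Vinv *v loglik_grad K Psi h x0 X n \<omega> \<theta>star
                      - (\<chi> j. integral\<^sup>L M (\<lambda>\<omega>'. (Vinv *v loglik_grad K Psi h x0 X n \<omega>' \<theta>star) $ j)))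
          in ln (integral\<^sup>L M (\<lambda>\<omega>. exp (lam * (\<gamma> \<bullet> \<zeta> \<omega>) / norm \<gamma>))) \<le> \<nu>0\<^sup>2 * lam\<^sup>2 / 2)"
    and cond_L0: "\<And>\<theta>. norm (msqrt (Dsq K Psi h n \<theta>star) *v (\<theta> - \<theta>star))
                        \<le> 4 * a * \<nu>0 * (sqrt (CARD('p)) + sqrt (2 * z)) \<Longrightarrow>
         onorm (\<lambda>x. (mat 1 - matrix_inv (msqrt (Dsq K Psi h n \<theta>star)) ** Dsq K Psi h n \<theta>
                          ** matrix_inv (msqrt (Dsq K Psi h n \<theta>star))) *v x) \<le> \<delta>"
    and cond_C: "4 * a * \<nu>0 * (sqrt (CARD('p)) + sqrt (2 * z)) * (1 - \<delta>)
                   \<ge> 2 * (a * \<nu>0 * (sqrt (CARD('p)) + sqrt (2 * z)))"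
  shows "measure M {\<omega> \<in> space M. norm (msqrt (Dsq K Psi h n \<theta>star) *v (\<theta>tilde \<omega> - \<theta>star))
                        > 4 * a * \<nu>0 * (sqrt (CARD('p)) + sqrt (2 * z))}
         \<le> 2 * exp (- z) + 8.4 * exp (- g\<^sup>2 / 4)"
proof -
  interpret M: prob_space M by fact
  obtain CK where CK: "\<And>t. norm (K t) \<le> CK" using K_bdd unfolding bounded_iff by blast
  obtain CP where CP: "\<And>t. norm (Psi t) \<le> CP" using Psi_bdd unfolding bounded_iff by blast
  interpret L: local_kernel K Psi CK CP
  proof
    show "K t \<le> CK" for t using CK[of t] by simp
  qed (use K_meas K_nonneg Psi_meas CP in auto)

  \<comment> \<open>The likelihood, its expectation and the centred score\<close>
  define c where "c = real n * h ^ CARD('d)"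
  have c: "c \<ge> 0" using h by (simp add: c_def)
  define S where "S = L.score_stat h x0 X n"
  have X_meas: "X i \<in> borel_measurable M" if "i < n" for i
    using distributed_measurable[OF distr[OF that]] by simp
  have S_meas [measurable]: "S \<in> borel_measurable M"
    unfolding S_def using X_meas by (rule L.score_stat_measurable)
  define B where "B = real n * (CK * CP)"
  have S_bound: "norm (S \<omega>) \<le> B" for \<omega> unfolding S_def B_def by (rule L.score_stat_bound)
  have S_int: "integrable M S" using S_bound by (intro M.integrable_const_bound[where B = B]) auto
  define m where "m = integral\<^sup>L M S"
  have S_inner: "integral\<^sup>L M (\<lambda>\<omega>. S \<omega> \<bullet> v) = m \<bullet> v" for v
    unfolding m_def using S_int by (rule integral_inner_left)
  have lik: "loglik K Psi h x0 X n \<omega> \<theta> = S \<omega> \<bullet> \<theta> - c * (\<integral>t. exp (Psi t \<bullet> \<theta>) \<partial>kernel_measure K)" for \<omega> \<theta>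
    unfolding S_def c_def by (rule L.loglik_eq)
  have Elik: "integral\<^sup>L M (\<lambda>\<omega>. loglik K Psi h x0 X n \<omega> \<theta>)
      = m \<bullet> \<theta> - c * (\<integral>t. exp (Psi t \<bullet> \<theta>) \<partial>kernel_measure K)" for \<theta>
    unfolding lik using S_int by (simp add: S_inner M.prob_space)
  \<comment> \<open>Optimality of \<open>\<theta>star\<close> identifies the deterministic part of
    the score with the mean \<open>m\<close> of \<open>S\<close>; hence \<open>Y = S - m\<close> is
    centred.\<close>
  have score: "m \<bullet> v = c * (\<integral>t. (Psi t \<bullet> v) * exp (Psi t \<bullet> \<theta>star) \<partial>kernel_measure K)" for v
    using target unfolding Elik by (rule L.score_eq_at_maximizer)
  define Y where "Y \<omega> = loglik_grad K Psi h x0 X n \<omega> \<theta>star" for \<omega>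
  have Y_inner: "Y \<omega> \<bullet> v = S \<omega> \<bullet> v - c * (\<integral>t. (Psi t \<bullet> v) * exp (Psi t \<bullet> \<theta>star) \<partial>kernel_measure K)" for \<omega> v
    unfolding Y_def S_def c_def by (rule L.loglik_grad_inner)
  have Y_eq: "Y \<omega> = S \<omega> - m" for \<omega>
    by (subst vector_eq_rdot[symmetric]) (simp add: Y_inner inner_diff_left score)
  have Y_meas [measurable]: "Y \<in> borel_measurable M" unfolding Y_eq[abs_def] by measurable
  have Y_bound: "norm (Y \<omega>) \<le> B + norm m" for \<omega>
    using norm_triangle_ineq4[of "S \<omega>" m] S_bound[of \<omega>] by (simp add: Y_eq)
  have Y_int: "integrable M Y" unfolding Y_eq[abs_def] using S_int by simp
  have Y_mean: "integral\<^sup>L M Y = 0" unfolding Y_eq[abs_def] using S_int by (simp add: m_def M.prob_space)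
  have Y_inner_mean: "integral\<^sup>L M (\<lambda>\<omega>. v \<bullet> Y \<omega>) = 0" for v
    using integral_inner_right[of v M Y] Y_int Y_mean by simp

  \<comment> \<open>The whitened score and its exponential moments\<close>
  define Q where "Q = cov_mat M Y"
  define V where "V = msqrt Q"
  have Q_pd: "pos_def_mat Q" using V_pd unfolding Q_def Y_def .
  have V: "pos_def_mat V" "V ** V = Q" using msqrt[OF Q_pd] by (simp_all add: V_def)
  have V_sym: "transpose V = V" using V by (simp add: pos_def_mat_def)
  note V_inv = matrix_inv_mult[OF pos_def_invertible[OF V(1)]]
  have Q_form: "w \<bullet> (Q *v w) = integral\<^sup>L M (\<lambda>\<omega>. (w \<bullet> Y \<omega>)\<^sup>2)" for w
    unfolding Q_def
  proof (rule cov_mat_quadratic_centered[OF M Y_meas Y_bound])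
    show "integral\<^sup>L M (\<lambda>\<omega>. Y \<omega> $ j) = 0" for j
      using Y_inner_mean[of "axis j 1"] by (simp add: inner_axis')
  qed
  have QV: "w \<bullet> (Q *v w) = (norm (V *v w))\<^sup>2" for w
    by (simp add: V(2)[symmetric] power2_norm_eq_inner symmetric_matrix_inner[OF V_sym] flip: matrix_vector_mul_assoc)
  define Vi where "Vi = matrix_inv V"
  have Vi_sym: "transpose Vi = Vi" unfolding Vi_def using V(1) by (rule symmetric_matrix_inv)
  define W where "W \<omega> = Vi *v Y \<omega>" for \<omega>
  have W_inner: "u \<bullet> W \<omega> = (Vi *v u) \<bullet> Y \<omega>" for u \<omega>
    by (simp add: W_def symmetric_matrix_inner[OF Vi_sym])
  have W_meas [measurable]: "W \<in> borel_measurable M"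
  proof -
    have "(*v) Vi \<in> borel_measurable borel"
      by (intro borel_measurable_continuous_onI linear_continuous_on) (simp add: matrix_vector_mul_bounded_linear)
    from measurable_compose[OF Y_meas this] show ?thesis by (simp add: W_def[abs_def])
  qed
  have W_inner_bound: "\<bar>u \<bullet> W \<omega>\<bar> \<le> norm (Vi *v u) * (B + norm m)" for u \<omega>
    unfolding W_inner using Cauchy_Schwarz_ineq2 mult_left_mono[OF Y_bound norm_ge_zero] by (rule order_trans)
  have W_mean: "integral\<^sup>L M (\<lambda>\<omega>. W \<omega> $ j) = 0" for j
    using Y_inner_mean[of "Vi *v axis j 1"] by (simp add: W_inner[symmetric] inner_axis')
  have W_exp_int: "integrable M (\<lambda>\<omega>. exp (u \<bullet> W \<omega>))" for u
  proof (rule M.integrable_bounded[where C = "exp (norm (Vi *v u) * (B + norm m))"])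
    show "\<bar>exp (u \<bullet> W \<omega>)\<bar> \<le> exp (norm (Vi *v u) * (B + norm m))" for \<omega>
      using W_inner_bound[of u \<omega>] by simp
  qed measurable
  have W_mgf: "integral\<^sup>L M (\<lambda>\<omega>. exp (u \<bullet> W \<omega>)) \<le> exp (\<nu>0\<^sup>2 * (norm u)\<^sup>2 / 2)" if u: "norm u \<le> g" for u
  proof (cases "u = 0")
    case False
    \<comment> \<open>Positivity allows the logarithm in (ED0) to be undone; it follows from a
      positive constant lower bound, as \<open>u \<bullet> W \<omega>\<close> is bounded.\<close>
    have "integral\<^sup>L M (\<lambda>\<omega>. exp (u \<bullet> W \<omega>)) > 0"
    proof -
      have "integral\<^sup>L M (\<lambda>\<omega>. exp (- (norm (Vi *v u) * (B + norm m)))) \<le> integral\<^sup>L M (\<lambda>\<omega>. exp (u \<bullet> W \<omega>))"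
      proof (rule integral_mono)
        show "exp (- (norm (Vi *v u) * (B + norm m))) \<le> exp (u \<bullet> W \<omega>)" for \<omega>
          using W_inner_bound[of u \<omega>] by simp
      qed (use W_exp_int in simp_all)
      thus ?thesis by (simp add: M.prob_space) (meson exp_gt_zero less_le_trans)
    qed
    moreover have "ln (integral\<^sup>L M (\<lambda>\<omega>. exp (u \<bullet> W \<omega>))) \<le> \<nu>0\<^sup>2 * (norm u)\<^sup>2 / 2"
    proof -
      have zero: "(\<chi> j. integral\<^sup>L M (\<lambda>\<omega>'. W \<omega>' $ j)) = 0" by (simp add: W_mean vec_eq_iff)
      have "\<bar>norm u\<bar> \<le> g" using u by simp
      \<comment> \<open>(ED0) is used with direction \<open>u\<close> and
        \<open>lam = norm u\<close>; its centring vector is zero by \<open>W_mean\<close>.\<close>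
      from cond_ED0[OF False this, folded Y_def, folded Q_def, folded V_def, folded Vi_def]
      have "ln (integral\<^sup>L M (\<lambda>\<omega>. exp (norm u * (u \<bullet> (W \<omega> - (\<chi> j. integral\<^sup>L M (\<lambda>\<omega>'. W \<omega>' $ j)))) / norm u)))
          \<le> \<nu>0\<^sup>2 * (norm u)\<^sup>2 / 2"
        unfolding Let_def W_def .
      thus ?thesis using False unfolding zero by simp
    qed
    ultimately show ?thesis by (metis exp_le_cancel_iff exp_ln)
  qed (simp add: M.prob_space)
  \<comment> \<open>\<open>W\<close> has identity covariance, so its sub-Gaussian constant is at least 1; hence
    \<open>W / \<nu>0\<close> is sub-Gaussian on a ball of radius \<open>\<nu>0 * g \<ge> g\<close>.\<close>
  have \<nu>0_ge: "1 \<le> \<nu>0"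
  proof -
    define u :: "real^'p" where "u = axis undefined 1"
    have nu: "norm u = 1" by (simp add: u_def norm_axis_1)
    have "integral\<^sup>L M (\<lambda>\<omega>. (u \<bullet> W \<omega>)\<^sup>2) \<le> \<nu>0\<^sup>2"
    proof (rule M.subgaussian_second_moment_le[OF _ W_inner_bound pos_params(3)])
      fix s assume "\<bar>s\<bar> \<le> g"
      with W_mgf[of "s *\<^sub>R u"] nu
      show "integral\<^sup>L M (\<lambda>\<omega>. exp (s * (u \<bullet> W \<omega>))) \<le> exp (\<nu>0\<^sup>2 * s\<^sup>2 / 2)" by simp
    qed measurable
    also have "integral\<^sup>L M (\<lambda>\<omega>. (u \<bullet> W \<omega>)\<^sup>2) = (norm (V *v (Vi *v u)))\<^sup>2"
      unfolding W_inner Q_form[symmetric] QV ..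
    also have "\<dots> = 1" unfolding Vi_def V_inv nu by simp
    finally have "1\<^sup>2 \<le> \<nu>0\<^sup>2" by simp
    thus ?thesis by (rule power2_le_imp_le) (use pos_params in simp)
  qed

  \<comment> \<open>Tail bound for the whitened score\<close>
  define A where "A = sqrt (CARD('p)) + sqrt (2 * z)"
  have A: "A > 0" using z by (simp add: A_def add_nonneg_pos)
  have tail: "measure M {\<omega> \<in> space M. norm ((1 / \<nu>0) *\<^sub>R W \<omega>) \<ge> 2 * A} \<le> 2 * exp (- z)"
  proof -
    have "measure M {\<omega> \<in> space M. norm ((1 / \<nu>0) *\<^sub>R W \<omega>) \<ge> 2 * (sqrt DIM(real^'p) + sqrt (2 * z))} \<le> 2 * exp (- z)"
    proof (rule subgaussian_norm_tail[where \<rho> = "\<nu>0 * g"])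
      fix \<gamma> :: "real^'p" assume \<gamma>: "norm \<gamma> \<le> \<nu>0 * g"
      let ?u = "(1 / \<nu>0) *\<^sub>R \<gamma>"
      have "norm ?u \<le> g" using \<gamma> pos_params by (simp add: divide_le_eq mult.commute)
      from W_mgf[OF this] have "integral\<^sup>L M (\<lambda>\<omega>. exp (?u \<bullet> W \<omega>)) \<le> exp ((norm \<gamma>)\<^sup>2 / 2)"
        using pos_params by (simp add: power_divide)
      thus "(\<integral>\<^sup>+\<omega>. ennreal (exp (\<gamma> \<bullet> (1 / \<nu>0) *\<^sub>R W \<omega>)) \<partial>M) \<le> ennreal (exp ((norm \<gamma>)\<^sup>2 / 2))"
        using nn_integral_eq_integral[OF W_exp_int[of ?u]] by (simp add: ennreal_leI)
    next
      have "g * 1 \<le> \<nu>0 * g" using \<nu>0_ge pos_params by simp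
      hence "g\<^sup>2 \<le> (\<nu>0 * g)\<^sup>2" using pos_params by (intro power_mono) auto
      thus "4 * z \<le> (\<nu>0 * g)\<^sup>2" using z by simp
    qed (use M z pos_params in auto)
    thus ?thesis by (simp add: A_def)
  qed

  \<comment> \<open>The information matrix and its root\<close>
  define R where "R = Dsq K Psi h n \<theta>star"
  define D where "D = msqrt R"
  have R_pd: "pos_def_mat R"
    unfolding pos_def_mat_def
  proof (intro conjI allI impI)
    show "transpose R = R" by (simp add: R_def Dsq_def transpose_def mult_ac)
    fix x :: "real^'p" assume "x \<noteq> 0"
    \<comment> \<open>Positive definiteness passes from the covariance \<open>Q\<close> to
      \<open>R\<close> through (I).\<close>
    hence "0 < x \<bullet> (Q *v x)" using Q_pd by (simp add: pos_def_mat_def)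
    also have "\<dots> \<le> x \<bullet> ((a\<^sup>2 *\<^sub>R R) *v x)"
      using cond_I unfolding loewner_le_def Q_def Y_def R_def by blast
    also have "\<dots> = a\<^sup>2 * (x \<bullet> (R *v x))" by (simp add: scaleR_matrix_vector_assoc[symmetric])
    finally show "0 < x \<bullet> (R *v x)" using pos_params by (simp add: zero_less_mult_iff)
  qed
  have D: "pos_def_mat D" "D ** D = R" using msqrt[OF R_pd] by (simp_all add: D_def)
  have D_sym: "transpose D = D" using D by (simp add: pos_def_mat_def)
  note D_inv = matrix_inv_mult[OF pos_def_invertible[OF D(1)]]
  have RD: "w \<bullet> (R *v w) = (norm (D *v w))\<^sup>2" for w
    by (simp add: D(2)[symmetric] power2_norm_eq_inner symmetric_matrix_inner[OF D_sym] flip: matrix_vector_mul_assoc)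
  have VD: "norm (V *v w) \<le> a * norm (D *v w)" for w
  proof (rule power2_le_imp_le)
    have "w \<bullet> (Q *v w) \<le> w \<bullet> ((a\<^sup>2 *\<^sub>R R) *v w)"
      using cond_I unfolding loewner_le_def Q_def Y_def R_def by blast
    also have "\<dots> = a\<^sup>2 * (w \<bullet> (R *v w))" by (simp add: scaleR_matrix_vector_assoc[symmetric])
    finally show "(norm (V *v w))\<^sup>2 \<le> (a * norm (D *v w))\<^sup>2"
      unfolding QV RD by (simp add: power_mult_distrib)
  qed (use pos_params in simp)
  define r where "r = 4 * a * \<nu>0 * A"
  have r: "r > 0" using A pos_params by (simp add: r_def)
  \<comment> \<open>The quadratic form of the matrix \<open>?N\<close> in (L0), tested on
    \<open>D *v v\<close>, is the difference of the two quadratic forms at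
    \<open>\<theta>star\<close> and \<open>\<theta>\<close>.\<close>
  have curv: "(1 - \<delta>) * (norm (D *v v))\<^sup>2 \<le> v \<bullet> (Dsq K Psi h n \<theta> *v v)"
    if "norm (D *v (\<theta> - \<theta>star)) \<le> r" for \<theta> v
  proof -
    let ?N = "mat 1 - matrix_inv D ** Dsq K Psi h n \<theta> ** matrix_inv D"
    let ?x = "D *v v"
    have on: "onorm (\<lambda>x. ?N *v x) \<le> \<delta>"
      using cond_L0[of \<theta>] that unfolding D_def R_def r_def A_def by blast
    have Nx: "?N *v ?x = ?x - matrix_inv D *v (Dsq K Psi h n \<theta> *v v)"
      by (simp add: matrix_vector_mult_diff_rdistrib D_inv flip: matrix_vector_mul_assoc)
    have "?x \<bullet> (?N *v ?x) \<le> norm ?x * norm (?N *v ?x)" by (rule norm_cauchy_schwarz)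
    also have "\<dots> \<le> norm ?x * (\<delta> * norm ?x)"
    proof (rule mult_left_mono)
      have "norm (?N *v ?x) \<le> onorm (\<lambda>x. ?N *v x) * norm ?x"
        by (rule onorm) (rule matrix_vector_mul_bounded_linear)
      also have "\<dots> \<le> \<delta> * norm ?x" using on by (rule mult_right_mono) simp
      finally show "norm (?N *v ?x) \<le> \<delta> * norm ?x" .
    qed simp
    also have "?x \<bullet> (?N *v ?x) = (norm ?x)\<^sup>2 - v \<bullet> (Dsq K Psi h n \<theta> *v v)"
      unfolding Nx inner_diff_right symmetric_matrix_inner[OF D_sym, of v "matrix_inv D *v _"] D_inv
      by (simp add: power2_norm_eq_inner)
    finally show ?thesis by (simp add: power2_eq_square algebra_simps)
  qed
  \<comment> \<open>The deterministic half: an estimator outside the ball forces a large whitened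
    score, so the event lies in the one bounded by \<open>tail\<close>.\<close>
  have incl: "norm ((1 / \<nu>0) *\<^sub>R W \<omega>) \<ge> 2 * A"
    if \<omega>: "\<omega> \<in> space M" and out: "r < norm (D *v (\<theta>tilde \<omega> - \<theta>star))" for \<omega>
  proof -
    define v where "v = \<theta>tilde \<omega> - \<theta>star"
    have "(1 - \<delta>) * r * norm (D *v v) \<le> S \<omega> \<bullet> v - c * (\<integral>t. (Psi t \<bullet> v) * exp (Psi t \<bullet> \<theta>star) \<partial>kernel_measure K)"
      unfolding v_def
    proof (rule L.score_lower_bound_outside[OF c matrix_vector_mul_linear less_imp_le[OF r] out])
      show "S \<omega> \<bullet> \<theta> - c * (\<integral>t. exp (Psi t \<bullet> \<theta>) \<partial>kernel_measure K)
          \<le> S \<omega> \<bullet> \<theta>tilde \<omega> - c * (\<integral>t. exp (Psi t \<bullet> \<theta>tilde \<omega>) \<partial>kernel_measure K)" for \<theta>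
        using MLE[OF \<omega>, of \<theta>] unfolding lik .
      fix \<theta> assume "norm (D *v (\<theta> - \<theta>star)) \<le> r"
      from curv[OF this, of "\<theta>tilde \<omega> - \<theta>star"]
      show "(1 - \<delta>) * (norm (D *v (\<theta>tilde \<omega> - \<theta>star)))\<^sup>2 \<le> c * (\<integral>t. (Psi t \<bullet> (\<theta>tilde \<omega> - \<theta>star)) *
          (Psi t \<bullet> (\<theta>tilde \<omega> - \<theta>star)) * exp (Psi t \<bullet> \<theta>) \<partial>kernel_measure K)"
        unfolding L.Dsq_inner c_def .
    qed
    also have "\<dots> = Y \<omega> \<bullet> v" by (simp add: Y_inner)
    \<comment> \<open>Moving \<open>V\<close> onto \<open>v\<close> prepares Cauchy-Schwarz;
      \<open>VD\<close> then exchanges \<open>V\<close> for \<open>D\<close>, so that the factor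
      \<open>norm (D *v v)\<close> cancels.\<close>
    also have "\<dots> = (V *v W \<omega>) \<bullet> v" unfolding W_def Vi_def V_inv ..
    also have "\<dots> = W \<omega> \<bullet> (V *v v)" by (rule symmetric_matrix_inner[OF V_sym])
    also have "\<dots> \<le> norm (W \<omega>) * norm (V *v v)" by (rule norm_cauchy_schwarz)
    also have "\<dots> \<le> norm (W \<omega>) * (a * norm (D *v v))" by (intro mult_left_mono VD) simp
    finally have "((1 - \<delta>) * r) * norm (D *v v) \<le> (a * norm (W \<omega>)) * norm (D *v v)" by (simp add: mult_ac)
    moreover have "norm (D *v v) > 0" using out r unfolding v_def by linarith
    ultimately have "(1 - \<delta>) * r \<le> a * norm (W \<omega>)" by (rule mult_right_le_imp_le)
    moreover have "2 * (a * \<nu>0 * A) \<le> r * (1 - \<delta>)" using cond_C by (simp add: r_def A_def)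
    ultimately have "a * (2 * A * \<nu>0) \<le> a * norm (W \<omega>)" by (simp add: mult_ac)
    hence "2 * A * \<nu>0 \<le> norm (W \<omega>)" using pos_params by simp
    thus ?thesis using pos_params by (simp add: le_divide_eq)
  qed
  have "measure M {\<omega> \<in> space M. norm (D *v (\<theta>tilde \<omega> - \<theta>star)) > r}
      \<le> measure M {\<omega> \<in> space M. norm ((1 / \<nu>0) *\<^sub>R W \<omega>) \<ge> 2 * A}"
    using incl by (intro M.finite_measure_mono) auto
  also note tail
  also have "2 * exp (- z) \<le> 2 * exp (- z) + 8.4 * exp (- g\<^sup>2 / 4)" by simp
  finally show ?thesis unfolding D_def R_def r_def A_def .
qed

end
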